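(* In the Delsarte-dual setting of the context, let $T$ be an $\mathbb{F}_{q^m}$-subspace of $\mathbb{V}(k,q^m)$ with $\langle T\cap U\rangle_{\mathbb{F}_{q^m}}=T$, and let $T^d$ be as defined in the context. Then: (1) $\mathbb{V}(k,q^m)^d=\{0\}$; (2) $\dim_{\mathbb{F}_{q^m}}(T^d)=n-k-\varepsilon_U(T)$; (3) $w_{U^d}(T^d)\ge n-w_U(T)$; (4) $\varepsilon_{U^d}(T^d)\ge k-\dim_{\mathbb{F}_{q^m}}(T)$; (5) $(T^d)^d\subseteq T$ and $\varepsilon_U((T^d)^d)\ge\varepsilon_U(T)$; (6) if $T'$ is an $\mathbb{F}_{q^m}$-subspace of $\mathbb{V}(k,q^m)$ with $T'\subseteq T$ and $\langle T'\cap U\rangle_{\mathbb{F}_{q^m}}=T'$, then $T^d\subseteq T'^d$.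
   Context: Let $q$ be a prime power, $m$ a positive integer, $1\le k<n$. Let $\mathbb{V}(n,q^m)$ be an $n$-dimensional $\mathbb{F}_{q^m}$-space and $W$ an $n$-dimensional $\mathbb{F}_q$-subspace with $\langle W\rangle_{\mathbb{F}_{q^m}}=\mathbb{V}(n,q^m)$. For an $\mathbb{F}_q$-subspace $S\subseteq W$ write $S^*=\langle S\rangle_{\mathbb{F}_{q^m}}$. Let $\sigma'$ be a non-degenerate reflexive $\mathbb{F}_q$-bilinear form on $W$ and $\sigma$ its unique $\mathbb{F}_{q^m}$-bilinear extension to $\mathbb{V}(n,q^m)$; $\perp$ is orthogonal complement w.r.t. $\sigma$. Let $\Gamma$ be an $(n-k)$-dimensional $\mathbb{F}_{q^m}$-subspace with $\Gamma\cap W=\{0\}$. Put $\mathbb{V}(k,q^m)=\mathbb{V}(n,q^m)/\Gamma$, $U=(W+\Gamma)/\Gamma$, $\mathbb{V}(n-k,q^m)=\mathbb{V}(n,q^m)/\Gamma^\perp$, $U^d=(W+\Gamma^\perp)/\Gamma^\perp$ (a Delsarte dual of $U$). Weight and defect: $w_U(T)=\dim_{\mathbb{F}_q}(U\cap T)$, $\varepsilon_U(T)=w_U(T)-\dim_{\mathbb{F}_{q^m}}T$. For an $\mathbb{F}_{q^m}$-subspace $T$ of $\mathbb{V}(k,q^m)$ with $\langle T\cap U\rangle=T$, let $S=\{w\in W: w+\Gamma\in T\}$ (an $\mathbb{F}_q$-subspace of $W$ of dimension $w_U(T)$ with $T\cap U=(S+\Gamma)/\Gamma$ and $T=(S^*+\Gamma)/\Gamma$),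 and define $T^d=((S^* )^\perp+\Gamma^\perp)/\Gamma^\perp\subseteq\mathbb{V}(n-k,q^m)$. Symmetrically, for an $\mathbb{F}_{q^m}$-subspace $X$ of $\mathbb{V}(n-k,q^m)$ with $\langle X\cap U^d\rangle=X$, let $R=\{w\in W: w+\Gamma^\perp\in X\}$ and $X^d=((R^* )^\perp+\Gamma)/\Gamma\subseteq\mathbb{V}(k,q^m)$.
   Formalization: Items (3) and (4) are proved under the added assumption that Γ^⊥ ∩ W = {0} (so that U^d has F_q-dimension n); without it both fail, e.g. q=m=k=2, n=3, dot product, Γ=⟨(1,ω,0)⟩, T=⟨e1,e2⟩/Γ. Items (1), (2), (5), (6) are unchanged. *)

theory Defs
  imports
    "Jordan_Normal_Form.Missing_VectorSpace"
    "HOL-Algebra.AbelCoset"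
    "HOL-Algebra.Subrings"
    "HOL-Number_Theory.Prime_Powers"
begin

text \<open>Restriction of scalars to a subfield \<open>K\<close> of \<open>F\<close> is expressed by viewing the same module
  record over \<open>F\<lparr>carrier := K\<rparr>\<close>.\<close>

text \<open>The coset space \<open>V / N\<close>. The \<open>mult\<close> and \<open>one\<close> fields are inherited from the
  ring record underlying \<open>module\<close> and play no role.\<close>

definition quot_space :: "('a, 'v, 'd) module_scheme \<Rightarrow> 'v set \<Rightarrow> ('a, 'v set) module" where
  "quot_space V N =
     \<lparr>carrier = a_rcosets\<^bsub>V\<^esub> N,
      monoid.mult = (\<lambda>_ _. N),
      one = N,
      zero = N,
      add = set_add V,
      smult = (\<lambda>c X. \<Union>x\<in>X. N +>\<^bsub>V\<^esub> (c \<odot>\<^bsub>V\<^esub> x))\<rparr>"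

text \<open>\<open>(A + N) / N\<close> as a set of cosets.\<close>

definition quot_image :: "('a, 'v, 'd) module_scheme \<Rightarrow> 'v set \<Rightarrow> 'v set \<Rightarrow> 'v set set" where
  "quot_image V N A = (\<lambda>v. N +>\<^bsub>V\<^esub> v) ` (A <+>\<^bsub>V\<^esub> N)"

definition bilinear_form ::
    "('a, 'r) ring_scheme \<Rightarrow> ('a, 'v, 'd) module_scheme \<Rightarrow> ('v \<Rightarrow> 'v \<Rightarrow> 'a) \<Rightarrow> bool" where
  "bilinear_form K V f \<longleftrightarrow>
     f \<in> carrier V \<rightarrow> carrier V \<rightarrow> carrier K \<and>
     (\<forall>x\<in>carrier V. \<forall>y\<in>carrier V. \<forall>z\<in>carrier V.
        f (x \<oplus>\<^bsub>V\<^esub> y) z = f x z \<oplus>\<^bsub>K\<^esub> f y z \<and>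
        f z (x \<oplus>\<^bsub>V\<^esub> y) = f z x \<oplus>\<^bsub>K\<^esub> f z y) \<and>
     (\<forall>c\<in>carrier K. \<forall>x\<in>carrier V. \<forall>y\<in>carrier V.
        f (c \<odot>\<^bsub>V\<^esub> x) y = c \<otimes>\<^bsub>K\<^esub> f x y \<and>
        f x (c \<odot>\<^bsub>V\<^esub> y) = c \<otimes>\<^bsub>K\<^esub> f x y)"

definition reflexive_form ::
    "('a, 'r) ring_scheme \<Rightarrow> ('a, 'v, 'd) module_scheme \<Rightarrow> ('v \<Rightarrow> 'v \<Rightarrow> 'a) \<Rightarrow> bool" where
  "reflexive_form K V f \<longleftrightarrow>
     (\<forall>x\<in>carrier V. \<forall>y\<in>carrier V. f x y = \<zero>\<^bsub>K\<^esub> \<longrightarrow> f y x = \<zero>\<^bsub>K\<^esub>)"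

definition nondegenerate_form ::
    "('a, 'r) ring_scheme \<Rightarrow> ('a, 'v, 'd) module_scheme \<Rightarrow> ('v \<Rightarrow> 'v \<Rightarrow> 'a) \<Rightarrow> bool" where
  "nondegenerate_form K V f \<longleftrightarrow>
     (\<forall>x\<in>carrier V. (\<forall>y\<in>carrier V. f x y = \<zero>\<^bsub>K\<^esub>) \<longrightarrow> x = \<zero>\<^bsub>V\<^esub>) \<and>
     (\<forall>y\<in>carrier V. (\<forall>x\<in>carrier V. f x y = \<zero>\<^bsub>K\<^esub>) \<longrightarrow> y = \<zero>\<^bsub>V\<^esub>)"

definition orth ::
    "('a, 'r) ring_scheme \<Rightarrow> ('a, 'v, 'd) module_scheme \<Rightarrow> ('v \<Rightarrow> 'v \<Rightarrow> 'a) \<Rightarrow> 'v set \<Rightarrow> 'v set" where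
  "orth F V f A = {v \<in> carrier V. \<forall>a\<in>A. f v a = \<zero>\<^bsub>F\<^esub>}"

abbreviation lspan ::
    "('a, 'r) ring_scheme \<Rightarrow> ('a, 'v, 'd) module_scheme \<Rightarrow> 'v set \<Rightarrow> 'v set" where
  "lspan F V A \<equiv> LinearCombinations.module.span F V A"

abbreviation sdim ::
    "('a, 'r) ring_scheme \<Rightarrow> ('a, 'v, 'd) module_scheme \<Rightarrow> 'v set \<Rightarrow> nat" where
  "sdim F V A \<equiv> vectorspace.dim F (V\<lparr>carrier := A\<rparr>)"

definition weight ::
    "('a, 'r) ring_scheme \<Rightarrow> 'a set \<Rightarrow> ('a, 'v, 'd) module_scheme \<Rightarrow> 'v set \<Rightarrow> 'v set \<Rightarrow> nat" where
  "weight F K V U T = sdim (F\<lparr>carrier := K\<rparr>) V (U \<inter> T)"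

definition defect ::
    "('a, 'r) ring_scheme \<Rightarrow> 'a set \<Rightarrow> ('a, 'v, 'd) module_scheme \<Rightarrow> 'v set \<Rightarrow> 'v set \<Rightarrow> int" where
  "defect F K V U T = int (weight F K V U T) - int (sdim F V T)"

text \<open>The dual in \<open>V / M\<close> of a subspace \<open>T\<close> of \<open>V / N\<close>: the map \<open>T \<mapsto> T\<^sup>d\<close> is the instance
  \<open>(N, M) = (\<Gamma>, \<Gamma>\<^sup>\<bottom>)\<close>, the map \<open>X \<mapsto> X\<^sup>d\<close> in the other direction is the instance
  \<open>(N, M) = (\<Gamma>\<^sup>\<bottom>, \<Gamma>)\<close>. Pitfall: \<open>\<Gamma> \<inter> W = {0}\<close> does not imply \<open>\<Gamma>\<^sup>\<bottom> \<inter> W = {0}\<close>, so \<open>W\<close> need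
  not embed into \<open>V / \<Gamma>\<^sup>\<bottom>\<close>; lower bounds on weights there require the latter condition.\<close>

definition subspace_dual ::
    "('a, 'r) ring_scheme \<Rightarrow> ('a, 'v, 'd) module_scheme \<Rightarrow> ('v \<Rightarrow> 'v \<Rightarrow> 'a) \<Rightarrow> 'v set \<Rightarrow>
     'v set \<Rightarrow> 'v set \<Rightarrow> 'v set set \<Rightarrow> 'v set set" where
  "subspace_dual F V f W N M T =
     quot_image V M (orth F V f (lspan F V {w \<in> W. N +>\<^bsub>V\<^esub> w \<in> T}))"

end

theory Submission
  imports Defs
begin

text \<open>Over a finite field every dimension can be read off a cardinality, so dimension formulas
  for quotients, sums and orthogonal complements reduce to counting fibres of additive maps. A
  \<open>K\<close>-basis of \<open>W\<close> is an \<open>F\<close>-basis of \<open>V\<close>; hence \<open>S \<mapsto> S\<^sup>*\<close> preserves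
  dimensions of subspaces \<open>S\<close> of \<open>W\<close>, the form \<open>\<sigma>\<close> is nondegenerate, and
  \<open>(S\<^sup>*)\<^sup>\<bottom>\<close> is spanned by the orthogonal complement of \<open>S\<close> inside \<open>W\<close>. The
  defect of \<open>T\<close> is the dimension of \<open>S\<^sup>* \<inter> \<Gamma>\<close>, and \<open>(S\<^sup>*)\<^sup>\<bottom> + \<Gamma>\<^sup>\<bottom>\<close> has
  codimension exactly that. No double orthogonal complement of \<open>\<Gamma>\<close> is needed: for the
  defect of the bidual it is enough that \<open>\<sigma> r v = 0\<close> implies \<open>\<sigma> v r = 0\<close> for \<open>r\<close> in
  \<open>W\<close> and \<open>v\<close> in \<open>V\<close>.\<close>

text \<open>Subtracting one point of a nonempty fibre carries that fibre onto
  \<open>H \<inter> N\<close>. Phrasing the kernel condition through differences lets the count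
  serve both coset maps and families of values of a form, with no group structure on the
  target.\<close>

lemma (in abelian_group) card_eq_card_image_times_card_kernel:
  assumes H: "additive_subgroup H G" and fin: "finite H"
    and ker: "\<And>x y. x \<in> H \<Longrightarrow> y \<in> H \<Longrightarrow> h x = h y \<longleftrightarrow> x \<ominus> y \<in> N"
  shows "card H = card (h ` H) * card (H \<inter> N)"
proof -
  interpret H: additive_subgroup H G by fact
  have sub: "\<And>x. x \<in> H \<Longrightarrow> x \<in> carrier G" using H.a_subset by auto
  have fibre: "card {x \<in> H. h x = y} = card (H \<inter> N)" if "y \<in> h ` H" for y
  proof -
    from that obtain z where z: "z \<in> H" "y = h z" by auto
    have "bij_betw (\<lambda>x. x \<ominus> z) {x \<in> H. h x = y} (H \<inter> N)"
    proof (rule bij_betw_byWitness[where f' = "\<lambda>u. u \<oplus> z"])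
      show "\<forall>x\<in>{x \<in> H. h x = y}. x \<ominus> z \<oplus> z = x"
        using sub z by (auto simp: a_minus_def a_assoc l_neg)
      show "\<forall>u\<in>H \<inter> N. u \<oplus> z \<ominus> z = u"
        using sub z by (auto simp: a_minus_def a_assoc r_neg)
      show "(\<lambda>x. x \<ominus> z) ` {x \<in> H. h x = y} \<subseteq> H \<inter> N"
        using ker z by (auto simp: a_minus_def)
      have "u \<oplus> z \<ominus> z = u" if "u \<in> H" for u
        using sub z that by (auto simp: a_minus_def a_assoc r_neg)
      then show "(\<lambda>u. u \<oplus> z) ` (H \<inter> N) \<subseteq> {x \<in> H. h x = y}"
        using ker z by auto
    qed
    then show ?thesis by (rule bij_betw_same_card)
  qed
  have "card H = (\<Sum>y\<in>h ` H. card {x \<in> H. h x = y})"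
    using sum.image_gen[OF fin, of "\<lambda>_. 1::nat" h] by simp
  also have "\<dots> = card (h ` H) * card (H \<inter> N)" using fibre by simp
  finally show ?thesis .
qed

section \<open>Subspaces, their sums, and the size of a space over a finite field\<close>

context vectorspace
begin

lemma subspaceI:
  assumes "A \<subseteq> carrier V" "\<zero>\<^bsub>V\<^esub> \<in> A"
    and "\<And>v w. v \<in> A \<Longrightarrow> w \<in> A \<Longrightarrow> v \<oplus>\<^bsub>V\<^esub> w \<in> A"
    and "\<And>c v. c \<in> carrier K \<Longrightarrow> v \<in> A \<Longrightarrow> c \<odot>\<^bsub>V\<^esub> v \<in> A"
  shows "VectorSpace.subspace K A V"
  using assms vectorspace_axioms module_axioms
  by (simp add: VectorSpace.subspace_def LinearCombinations.submodule_def)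

lemma subspaceD:
  assumes "VectorSpace.subspace K A V"
  shows "A \<subseteq> carrier V" "\<zero>\<^bsub>V\<^esub> \<in> A"
    and "\<And>v w. v \<in> A \<Longrightarrow> w \<in> A \<Longrightarrow> v \<oplus>\<^bsub>V\<^esub> w \<in> A"
    and "\<And>c v. c \<in> carrier K \<Longrightarrow> v \<in> A \<Longrightarrow> c \<odot>\<^bsub>V\<^esub> v \<in> A"
    and "\<And>v. v \<in> A \<Longrightarrow> \<ominus>\<^bsub>V\<^esub> v \<in> A"
    and "\<And>v w. v \<in> A \<Longrightarrow> w \<in> A \<Longrightarrow> v \<ominus>\<^bsub>V\<^esub> w \<in> A"
proof -
  interpret LinearCombinations.submodule K A V using assms by simp
  show "A \<subseteq> carrier V" "\<zero>\<^bsub>V\<^esub> \<in> A" by (auto simp: subset)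
  show add: "\<And>v w. v \<in> A \<Longrightarrow> w \<in> A \<Longrightarrow> v \<oplus>\<^bsub>V\<^esub> w \<in> A"
    and smult: "\<And>c v. c \<in> carrier K \<Longrightarrow> v \<in> A \<Longrightarrow> c \<odot>\<^bsub>V\<^esub> v \<in> A"
    by auto
  show neg: "\<ominus>\<^bsub>V\<^esub> v \<in> A" if "v \<in> A" for v
  proof -
    have "v \<in> carrier V" using that subset by auto
    then show ?thesis using smult[of "\<ominus>\<^bsub>K\<^esub> \<one>\<^bsub>K\<^esub>" v] that by (simp flip: smult_minus_1)
  qed
  show "\<And>v w. v \<in> A \<Longrightarrow> w \<in> A \<Longrightarrow> v \<ominus>\<^bsub>V\<^esub> w \<in> A"
    using add neg by (auto simp: a_minus_def)
qed

lemma subspace_additive_subgroup: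
  assumes "VectorSpace.subspace K A V"
  shows "additive_subgroup A V"
proof (rule additive_subgroupI, rule M.add.subgroupI)
  show "A \<noteq> {}" using subspaceD(2)[OF assms] by auto
qed (use subspaceD[OF assms] in auto)

lemma subspace_carrier: "VectorSpace.subspace K (carrier V) V"
  by (rule subspaceI) auto

lemma subspace_Int:
  assumes "VectorSpace.subspace K A V" "VectorSpace.subspace K B V"
  shows "VectorSpace.subspace K (A \<inter> B) V"
  using subspaceD[OF assms(1)] subspaceD[OF assms(2)] by (intro subspaceI) auto

lemma set_add_iff: "v \<in> A <+>\<^bsub>V\<^esub> B \<longleftrightarrow> (\<exists>a\<in>A. \<exists>b\<in>B. v = a \<oplus>\<^bsub>V\<^esub> b)"
  by (auto simp: set_add_def')

lemma subspace_set_add: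
  assumes "VectorSpace.subspace K A V" "VectorSpace.subspace K B V"
  shows "VectorSpace.subspace K (A <+>\<^bsub>V\<^esub> B) V"
proof (rule subspaceI)
  note A = subspaceD[OF assms(1)] and B = subspaceD[OF assms(2)]
  show "A <+>\<^bsub>V\<^esub> B \<subseteq> carrier V" using A(1) B(1) by (rule M.setadd_subset_G)
  show "\<zero>\<^bsub>V\<^esub> \<in> A <+>\<^bsub>V\<^esub> B" using A(2) B(2) by (force simp: set_add_iff)
  fix v w assume v: "v \<in> A <+>\<^bsub>V\<^esub> B" and w: "w \<in> A <+>\<^bsub>V\<^esub> B"
  from v obtain a b where ab: "a \<in> A" "b \<in> B" "v = a \<oplus>\<^bsub>V\<^esub> b" by (auto simp: set_add_iff)
  from w obtain a' b' where ab': "a' \<in> A" "b' \<in> B" "w = a' \<oplus>\<^bsub>V\<^esub> b'" by (auto simp: set_add_iff)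
  have c: "a \<in> carrier V" "b \<in> carrier V" "a' \<in> carrier V" "b' \<in> carrier V"
    using ab ab' A(1) B(1) by auto
  then have "v \<oplus>\<^bsub>V\<^esub> w = (a \<oplus>\<^bsub>V\<^esub> a') \<oplus>\<^bsub>V\<^esub> (b \<oplus>\<^bsub>V\<^esub> b')"
    using ab ab' by (simp add: M.add.m_ac)
  then show "v \<oplus>\<^bsub>V\<^esub> w \<in> A <+>\<^bsub>V\<^esub> B"
    using ab ab' A(3) B(3) unfolding set_add_iff by metis
next
  note A = subspaceD[OF assms(1)] and B = subspaceD[OF assms(2)]
  fix c v assume c: "c \<in> carrier K" and v: "v \<in> A <+>\<^bsub>V\<^esub> B"
  from v obtain a b where ab: "a \<in> A" "b \<in> B" "v = a \<oplus>\<^bsub>V\<^esub> b" by (auto simp: set_add_iff)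
  then have "c \<odot>\<^bsub>V\<^esub> v = c \<odot>\<^bsub>V\<^esub> a \<oplus>\<^bsub>V\<^esub> c \<odot>\<^bsub>V\<^esub> b"
    using c A(1) B(1) by (auto intro!: smult_r_distr)
  then show "c \<odot>\<^bsub>V\<^esub> v \<in> A <+>\<^bsub>V\<^esub> B"
    using c ab A(4) B(4) unfolding set_add_iff by metis
qed

lemma subset_set_add:
  assumes "VectorSpace.subspace K A V" "VectorSpace.subspace K B V"
  shows "A \<subseteq> A <+>\<^bsub>V\<^esub> B" "B \<subseteq> A <+>\<^bsub>V\<^esub> B"
proof -
  note A = subspaceD[OF assms(1)] and B = subspaceD[OF assms(2)]
  show "A \<subseteq> A <+>\<^bsub>V\<^esub> B"
  proof
    fix a assume "a \<in> A"
    moreover from this have "a = a \<oplus>\<^bsub>V\<^esub> \<zero>\<^bsub>V\<^esub>" using A(1) by auto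
    ultimately show "a \<in> A <+>\<^bsub>V\<^esub> B" using B(2) by (auto simp: set_add_iff)
  qed
  show "B \<subseteq> A <+>\<^bsub>V\<^esub> B"
  proof
    fix b assume "b \<in> B"
    moreover from this have "b = \<zero>\<^bsub>V\<^esub> \<oplus>\<^bsub>V\<^esub> b" using B(1) by auto
    ultimately show "b \<in> A <+>\<^bsub>V\<^esub> B" using A(2) by (auto simp: set_add_iff)
  qed
qed

lemma span_subset_subspace:
  assumes "VectorSpace.subspace K A V" "S \<subseteq> A"
  shows "span S \<subseteq> A"
  using assms by (intro span_is_subset) (auto simp: VectorSpace.subspace_def)

lemma card_carrier_eq:
  assumes "fin_dim" "finite (carrier K)"
  shows "finite (carrier V)" "card (carrier V) = card (carrier K) ^ dim"
proof -
  obtain B where B: "finite B" "basis B" using finite_basis_exists assms(1) by auto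
  have BV: "B \<subseteq> carrier V" using B by (auto simp: basis_def)
  have ex: "\<And>v. v \<in> carrier V \<Longrightarrow> \<exists>!a. a \<in> B \<rightarrow>\<^sub>E carrier K \<and> lincomb a B = v"
    using basis_criterion[OF B(1) BV] B(2) by blast
  \<comment> \<open>Coordinates are taken as extensional functions on the basis, so each vector has
    exactly one family of them and the families can be counted.\<close>
  have bij: "bij_betw (\<lambda>a. lincomb a B) (B \<rightarrow>\<^sub>E carrier K) (carrier V)"
  proof (rule bij_betwI')
    show "\<exists>a\<in>B \<rightarrow>\<^sub>E carrier K. v = lincomb a B" if "v \<in> carrier V" for v
      using ex[OF that] by auto
    show mem: "lincomb a B \<in> carrier V" if "a \<in> B \<rightarrow>\<^sub>E carrier K" for a
      using that BV by (intro lincomb_closed) auto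
    show "(lincomb a B = lincomb b B) = (a = b)"
      if "a \<in> B \<rightarrow>\<^sub>E carrier K" "b \<in> B \<rightarrow>\<^sub>E carrier K" for a b
      using ex[OF mem[OF that(1)]] that by metis
  qed
  have "finite (B \<rightarrow>\<^sub>E carrier K)" using B assms by (intro finite_PiE) auto
  then show "finite (carrier V)" using bij bij_betw_finite by blast
  show "card (carrier V) = card (carrier K) ^ dim"
    using bij_betw_same_card[OF bij] B(1) dim_basis[OF B] by (simp add: card_PiE)
qed

text \<open>The whole carrier is a finite generating set.\<close>

lemma finite_carrier_imp_fin_dim:
  assumes "finite (carrier V)"
  shows fin_dim
  unfolding fin_dim_def using assms in_own_span[of "carrier V"] span_is_subset2[of "carrier V"]
  by auto

end

section \<open>Dimensions read off cardinalities\<close>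

locale finite_vectorspace = vectorspace K V for K and V +
  assumes finite_field: "finite (carrier K)"
    and finite_space: "finite (carrier V)"
begin

lemma fin_dim: fin_dim
  using finite_space by (rule finite_carrier_imp_fin_dim)

text \<open>A base above 1 makes powers strictly increasing in the exponent, so comparisons of
  cardinalities turn into comparisons of dimensions.\<close>

lemma card_field_gt_1: "1 < card (carrier K)"
proof -
  have "card {\<zero>\<^bsub>K\<^esub>, \<one>\<^bsub>K\<^esub>} \<le> card (carrier K)"
    by (rule card_mono) (auto simp: finite_field)
  then show ?thesis by simp
qed

lemma finite_subspace:
  assumes "VectorSpace.subspace K A V"
  shows "finite A"
  using subspaceD(1)[OF assms] finite_space finite_subset by auto

lemma finite_vectorspace_subspace:
  assumes "VectorSpace.subspace K A V"
  shows "finite_vectorspace K (vs A)"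
  using subspace_is_vs[OF assms] finite_subspace[OF assms] finite_field
  by (simp add: finite_vectorspace_def finite_vectorspace_axioms_def)

lemma card_subspace:
  assumes "VectorSpace.subspace K A V"
  shows "card A = card (carrier K) ^ sdim K V A"
proof -
  interpret A: finite_vectorspace K "vs A" using assms by (rule finite_vectorspace_subspace)
  show ?thesis using A.card_carrier_eq(2)[OF A.fin_dim finite_field] by simp
qed

lemma card_eq_power_imp_sdim:
  assumes "VectorSpace.subspace K A V" "card A = card (carrier K) ^ d"
  shows "sdim K V A = d"
  using assms card_subspace[OF assms(1)] card_field_gt_1 by simp

lemma sdim_carrier: "sdim K V (carrier V) = dim"
  by simp

lemma sdim_mono:
  assumes "VectorSpace.subspace K A V" "VectorSpace.subspace K B V" "A \<subseteq> B"
  shows "sdim K V A \<le> sdim K V B"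
proof -
  have "card A \<le> card B" using assms finite_subspace card_mono by blast
  then show ?thesis
    using card_subspace assms card_field_gt_1 by (simp add: power_increasing_iff)
qed

lemma sdim_eq_imp_eq:
  assumes "VectorSpace.subspace K A V" "VectorSpace.subspace K B V" "A \<subseteq> B" "sdim K V B \<le> sdim K V A"
  shows "A = B"
proof -
  have "sdim K V A = sdim K V B" using sdim_mono[OF assms(1-3)] assms(4) by simp
  then have "card A = card B" using card_subspace assms by simp
  then show ?thesis using assms finite_subspace card_subset_eq by blast
qed

lemma subspace_basis:
  assumes "VectorSpace.subspace K A V"
  obtains B where "finite B" "B \<subseteq> A" "lin_indpt B" "span B = A" "card B = sdim K V A"
proof -
  interpret A: finite_vectorspace K "vs A" using assms by (rule finite_vectorspace_subspace)
  obtain B where B: "finite B" "A.basis B" using A.finite_basis_exists A.fin_dim by auto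
  have BA: "B \<subseteq> A" using B by (simp add: A.basis_def)
  \<comment> \<open>Span and independence of a subset of \<open>A\<close> are the same in
    \<open>A\<close> as in \<open>V\<close>, so a basis of \<open>A\<close> as a space of its own is
    what is wanted.\<close>
  have sub: "LinearCombinations.submodule K A V" using assms by simp
  show thesis
    using that[of B] B BA A.dim_basis[OF B] span_li_not_depend[OF BA sub]
    by (simp add: A.basis_def)
qed

end

section \<open>Quotient spaces and the images of subspaces in them\<close>

context vectorspace
begin

lemma abelian_subgroup_subspace:
  assumes "VectorSpace.subspace K N V"
  shows "abelian_subgroup N V"
  using subspace_additive_subgroup[OF assms] M.abelian_group_axioms by (rule abelian_subgroupI3)

lemma coset_eq_iff:
  assumes N: "VectorSpace.subspace K N V" and "v \<in> carrier V" "w \<in> carrier V"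
  shows "N +>\<^bsub>V\<^esub> v = N +>\<^bsub>V\<^esub> w \<longleftrightarrow> v \<ominus>\<^bsub>V\<^esub> w \<in> N"
proof -
  have sub: "N \<subseteq> carrier V" using subspaceD(1)[OF N] .
  have sg: "subgroup N (add_monoid V)"
    using subspace_additive_subgroup[OF N] by (rule additive_subgroup.a_subgroup)
  have c: "v \<ominus>\<^bsub>V\<^esub> w \<in> carrier V" using assms by simp
  \<comment> \<open>Translating both cosets by the negative of \<open>w\<close> turns the second one
    into \<open>N\<close>.\<close>
  have "N +>\<^bsub>V\<^esub> v = N +>\<^bsub>V\<^esub> w \<longleftrightarrow> N +>\<^bsub>V\<^esub> (v \<ominus>\<^bsub>V\<^esub> w) = N"
    using M.a_coset_add_inv1 M.a_coset_add_inv2 assms sub unfolding a_minus_def by metis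
  also have "\<dots> \<longleftrightarrow> v \<ominus>\<^bsub>V\<^esub> w \<in> N"
    using M.a_coset_join1[OF _ c sg] M.a_coset_join2[OF c sg] by auto
  finally show ?thesis .
qed

lemma quot_space_simps:
  assumes N: "VectorSpace.subspace K N V"
  shows "carrier (quot_space V N) = (\<lambda>v. N +>\<^bsub>V\<^esub> v) ` carrier V"
    and "\<zero>\<^bsub>quot_space V N\<^esub> = N"
    and "\<And>v w. v \<in> carrier V \<Longrightarrow> w \<in> carrier V \<Longrightarrow>
      (N +>\<^bsub>V\<^esub> v) \<oplus>\<^bsub>quot_space V N\<^esub> (N +>\<^bsub>V\<^esub> w) = N +>\<^bsub>V\<^esub> (v \<oplus>\<^bsub>V\<^esub> w)"
    and "\<And>c v. c \<in> carrier K \<Longrightarrow> v \<in> carrier V \<Longrightarrow>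
      c \<odot>\<^bsub>quot_space V N\<^esub> (N +>\<^bsub>V\<^esub> v) = N +>\<^bsub>V\<^esub> (c \<odot>\<^bsub>V\<^esub> v)"
proof -
  interpret N: abelian_subgroup N V using N by (rule abelian_subgroup_subspace)
  show "carrier (quot_space V N) = (\<lambda>v. N +>\<^bsub>V\<^esub> v) ` carrier V"
    by (auto simp: quot_space_def A_RCOSETS_def')
  show "\<zero>\<^bsub>quot_space V N\<^esub> = N" by (simp add: quot_space_def)
  show "(N +>\<^bsub>V\<^esub> v) \<oplus>\<^bsub>quot_space V N\<^esub> (N +>\<^bsub>V\<^esub> w) = N +>\<^bsub>V\<^esub> (v \<oplus>\<^bsub>V\<^esub> w)"
    if "v \<in> carrier V" "w \<in> carrier V" for v w
    using that N.a_rcos_sum by (simp add: quot_space_def)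
  fix c v assume c: "c \<in> carrier K" and v: "v \<in> carrier V"
  \<comment> \<open>Scalar multiplication of cosets is defined as a union over representatives. Each
    of them contributes the same coset, and \<open>v\<close> itself is one of them, so the union
    collapses to a single coset.\<close>
  have indep: "N +>\<^bsub>V\<^esub> (c \<odot>\<^bsub>V\<^esub> x) = N +>\<^bsub>V\<^esub> (c \<odot>\<^bsub>V\<^esub> v)" if "x \<in> N +>\<^bsub>V\<^esub> v" for x
  proof -
    from that obtain u where u: "u \<in> N" "x = u \<oplus>\<^bsub>V\<^esub> v" by (auto simp: a_r_coset_def')
    have uV: "u \<in> carrier V" using u subspaceD(1)[OF N] by auto
    have "c \<odot>\<^bsub>V\<^esub> x \<ominus>\<^bsub>V\<^esub> c \<odot>\<^bsub>V\<^esub> v = c \<odot>\<^bsub>V\<^esub> u"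
      using c v uV u by (simp add: smult_r_distr a_minus_def M.a_assoc M.r_neg)
    then show ?thesis
      using coset_eq_iff[OF N, of "c \<odot>\<^bsub>V\<^esub> x" "c \<odot>\<^bsub>V\<^esub> v"] c v uV u subspaceD(4)[OF N]
      by simp
  qed
  have "c \<odot>\<^bsub>quot_space V N\<^esub> (N +>\<^bsub>V\<^esub> v) = (\<Union>x\<in>N +>\<^bsub>V\<^esub> v. N +>\<^bsub>V\<^esub> (c \<odot>\<^bsub>V\<^esub> x))"
    by (simp add: quot_space_def)
  also have "\<dots> = (\<Union>x\<in>N +>\<^bsub>V\<^esub> v. N +>\<^bsub>V\<^esub> (c \<odot>\<^bsub>V\<^esub> v))"
    using indep by (rule SUP_cong[OF refl])
  also have "\<dots> = N +>\<^bsub>V\<^esub> (c \<odot>\<^bsub>V\<^esub> v)" using N.a_rcos_self[OF v] by blast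
  finally show "c \<odot>\<^bsub>quot_space V N\<^esub> (N +>\<^bsub>V\<^esub> v) = N +>\<^bsub>V\<^esub> (c \<odot>\<^bsub>V\<^esub> v)" .
qed

lemma vectorspace_quot_space:
  assumes N: "VectorSpace.subspace K N V"
  shows "vectorspace K (quot_space V N)"
proof -
  note s = quot_space_simps[OF N]
  have z: "N = N +>\<^bsub>V\<^esub> \<zero>\<^bsub>V\<^esub>" using subspaceD(1)[OF N] by simp
  have neg: "\<exists>Y\<in>carrier (quot_space V N). X \<oplus>\<^bsub>quot_space V N\<^esub> Y = \<zero>\<^bsub>quot_space V N\<^esub>"
    if "X \<in> carrier (quot_space V N)" for X
  proof -
    from that obtain v where v: "v \<in> carrier V" "X = N +>\<^bsub>V\<^esub> v" by (auto simp: s)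
    then have "X \<oplus>\<^bsub>quot_space V N\<^esub> (N +>\<^bsub>V\<^esub> (\<ominus>\<^bsub>V\<^esub> v)) = \<zero>\<^bsub>quot_space V N\<^esub>"
      using z by (simp add: s M.r_neg)
    then show ?thesis using v by (auto simp: s)
  qed
  \<comment> \<open>As a coset of the zero vector, the zero of the quotient fits the rule for sums
    of cosets; \<open>M.a_coset_add_zero\<close> is deleted below where it would undo this
    form.\<close>
  have zero: "\<zero>\<^bsub>quot_space V N\<^esub> = N +>\<^bsub>V\<^esub> \<zero>\<^bsub>V\<^esub>" using z s(2) by simp
  show ?thesis
    apply (rule vs_criteria)
               apply (rule field_axioms)
              apply (force simp: zero s(1))
             apply (force simp: s(1,3))
    using neg apply blast
           apply (force simp: s(1,4))
          apply (clarsimp simp: s(1,3))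
    subgoal by (simp only: M.a_comm)
         apply (clarsimp simp: s(1,3) M.a_assoc)
        apply (clarsimp simp: s(1,3) zero simp del: M.a_coset_add_zero)
       apply (clarsimp simp: s(1,4) smult_assoc1)
      apply (clarsimp simp: s(1,4))
     apply (clarsimp simp: s(1,3,4) smult_l_distr)
    apply (clarsimp simp: s(1,3,4) smult_r_distr)
    done
qed

text \<open>Adding an element of \<open>N\<close> does not move a coset, so representatives from
  \<open>A\<close> alone give the whole image.\<close>

lemma quot_image_eq:
  assumes N: "VectorSpace.subspace K N V" and A: "A \<subseteq> carrier V"
  shows "quot_image V N A = (\<lambda>v. N +>\<^bsub>V\<^esub> v) ` A"
proof -
  have shift: "N +>\<^bsub>V\<^esub> (a \<oplus>\<^bsub>V\<^esub> u) = N +>\<^bsub>V\<^esub> a" if "a \<in> A" "u \<in> N" for a u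
  proof -
    have c: "a \<in> carrier V" "u \<in> carrier V" using that A subspaceD(1)[OF N] by auto
    then have "a \<oplus>\<^bsub>V\<^esub> u \<ominus>\<^bsub>V\<^esub> a = u"
      by (metis M.a_comm M.add.inv_solve_right' M.add.m_closed a_minus_def)
    then show ?thesis using coset_eq_iff[OF N, of "a \<oplus>\<^bsub>V\<^esub> u" a] c that by simp
  qed
  show ?thesis
  proof
    show "quot_image V N A \<subseteq> (\<lambda>v. N +>\<^bsub>V\<^esub> v) ` A"
      by (auto simp: quot_image_def set_add_iff shift)
    show "(\<lambda>v. N +>\<^bsub>V\<^esub> v) ` A \<subseteq> quot_image V N A"
    proof (rule image_subsetI)
      fix a assume a: "a \<in> A"
      then have "a = a \<oplus>\<^bsub>V\<^esub> \<zero>\<^bsub>V\<^esub>" using A by auto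
      then have "a \<in> A <+>\<^bsub>V\<^esub> N" using a subspaceD(2)[OF N] unfolding set_add_iff by blast
      then show "N +>\<^bsub>V\<^esub> a \<in> quot_image V N A" by (simp add: quot_image_def)
    qed
  qed
qed

text \<open>Serves to split a vector whose coset lies in a dual into a component from
  \<open>A\<close> and one from \<open>N\<close>.\<close>

lemma coset_in_quot_image_iff:
  assumes N: "VectorSpace.subspace K N V" and A: "A \<subseteq> carrier V" and v: "v \<in> carrier V"
  shows "N +>\<^bsub>V\<^esub> v \<in> quot_image V N A \<longleftrightarrow> v \<in> A <+>\<^bsub>V\<^esub> N"
proof
  assume "N +>\<^bsub>V\<^esub> v \<in> quot_image V N A"
  then obtain a where a: "a \<in> A" "N +>\<^bsub>V\<^esub> v = N +>\<^bsub>V\<^esub> a"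
    by (auto simp: quot_image_eq[OF N A])
  then have "v \<ominus>\<^bsub>V\<^esub> a \<in> N" using coset_eq_iff[OF N v] A by blast
  moreover have "v = a \<oplus>\<^bsub>V\<^esub> (v \<ominus>\<^bsub>V\<^esub> a)"
  proof -
    have "a \<in> carrier V" using a A by auto
    then show ?thesis using v M.a_lcomm[of a v "\<ominus>\<^bsub>V\<^esub> a"] by (simp add: a_minus_def M.r_neg)
  qed
  ultimately show "v \<in> A <+>\<^bsub>V\<^esub> N" using a unfolding set_add_iff by blast
qed (simp add: quot_image_def)

lemma subspace_quot_image:
  assumes N: "VectorSpace.subspace K N V" and A: "VectorSpace.subspace K A V"
  shows "VectorSpace.subspace K (quot_image V N A) (quot_space V N)"
proof -
  interpret Q: vectorspace K "quot_space V N" using N by (rule vectorspace_quot_space)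
  note s = quot_space_simps[OF N] and A' = subspaceD[OF A]
  have AV: "\<And>a. a \<in> A \<Longrightarrow> a \<in> carrier V" using A'(1) by auto
  have "N +>\<^bsub>V\<^esub> \<zero>\<^bsub>V\<^esub> = N" using subspaceD(1)[OF N] by simp
  then have "N \<in> (\<lambda>v. N +>\<^bsub>V\<^esub> v) ` A" using A'(2) by force
  then show ?thesis
    unfolding quot_image_eq[OF N A'(1)]
    by (intro Q.subspaceI) (auto simp: s AV A'(3,4))
qed

lemma subspace_quot_preimage:
  assumes N: "VectorSpace.subspace K N V" and T: "VectorSpace.subspace K T (quot_space V N)"
  shows "VectorSpace.subspace K {v \<in> carrier V. N +>\<^bsub>V\<^esub> v \<in> T} V"
proof -
  interpret Q: vectorspace K "quot_space V N" using N by (rule vectorspace_quot_space)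
  note s = quot_space_simps[OF N] and T' = Q.subspaceD[OF T]
  show ?thesis
  proof (rule subspaceI)
    show "\<zero>\<^bsub>V\<^esub> \<in> {v \<in> carrier V. N +>\<^bsub>V\<^esub> v \<in> T}"
      using T'(2) subspaceD(1)[OF N] by (simp add: s)
    show "v \<oplus>\<^bsub>V\<^esub> w \<in> {v \<in> carrier V. N +>\<^bsub>V\<^esub> v \<in> T}"
      if "v \<in> {v \<in> carrier V. N +>\<^bsub>V\<^esub> v \<in> T}" "w \<in> {v \<in> carrier V. N +>\<^bsub>V\<^esub> v \<in> T}" for v w
      using that T'(3)[of "N +>\<^bsub>V\<^esub> v" "N +>\<^bsub>V\<^esub> w"] by (simp add: s)
    show "c \<odot>\<^bsub>V\<^esub> v \<in> {v \<in> carrier V. N +>\<^bsub>V\<^esub> v \<in> T}"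
      if "c \<in> carrier K" "v \<in> {v \<in> carrier V. N +>\<^bsub>V\<^esub> v \<in> T}" for c v
      using that T'(4)[of c "N +>\<^bsub>V\<^esub> v"] by (simp add: s)
  qed auto
qed

end

section \<open>Dimension formulas for quotients and sums\<close>

context finite_vectorspace
begin

lemma finite_vectorspace_quot_space:
  assumes N: "VectorSpace.subspace K N V"
  shows "finite_vectorspace K (quot_space V N)"
proof -
  have "finite (carrier (quot_space V N))"
    using quot_space_simps(1)[OF N] finite_space by simp
  then show ?thesis
    using vectorspace_quot_space[OF N] finite_field
    by (simp add: finite_vectorspace_def finite_vectorspace_axioms_def)
qed

text \<open>Rank-nullity for the coset map on \<open>A\<close>: its kernel there is
  \<open>A \<inter> N\<close>, and counting fibres gives an equation between powers of the field
  order.\<close>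

lemma sdim_quot_image:
  assumes N: "VectorSpace.subspace K N V" and A: "VectorSpace.subspace K A V"
  shows "sdim K (quot_space V N) (quot_image V N A) + sdim K V (A \<inter> N) = sdim K V A"
proof -
  interpret Q: finite_vectorspace K "quot_space V N"
    using N by (rule finite_vectorspace_quot_space)
  have AV: "A \<subseteq> carrier V" using subspaceD(1)[OF A] .
  have "card A = card ((\<lambda>v. N +>\<^bsub>V\<^esub> v) ` A) * card (A \<inter> N)"
  proof (rule M.card_eq_card_image_times_card_kernel)
    show "additive_subgroup A V" using A by (rule subspace_additive_subgroup)
    show "finite A" using A by (rule finite_subspace)
  qed (use AV coset_eq_iff[OF N] in blast)
  then have "card A = card (quot_image V N A) * card (A \<inter> N)"
    using quot_image_eq[OF N AV] by simp
  then have "card (carrier K) ^ sdim K V A =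
      card (carrier K) ^ (sdim K (quot_space V N) (quot_image V N A) + sdim K V (A \<inter> N))"
    unfolding power_add card_subspace[OF A] card_subspace[OF subspace_Int[OF A N]]
      Q.card_subspace[OF subspace_quot_image[OF N A]] .
  then show ?thesis using power_inject_exp[OF card_field_gt_1] by simp
qed

lemma sdim_zero: "sdim K V {\<zero>\<^bsub>V\<^esub>} = 0"
proof (rule card_eq_power_imp_sdim)
  show "VectorSpace.subspace K {\<zero>\<^bsub>V\<^esub>} V" by (rule subspaceI) auto
qed simp

text \<open>\<open>A\<close> and the sum have the same image modulo \<open>B\<close>, so two
  instances of the quotient formula can be compared: one loses \<open>A \<inter> B\<close>, the
  other all of \<open>B\<close>.\<close>

lemma sdim_set_add:
  assumes A: "VectorSpace.subspace K A V" and B: "VectorSpace.subspace K B V"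
  shows "sdim K V (A <+>\<^bsub>V\<^esub> B) + sdim K V (A \<inter> B) = sdim K V A + sdim K V B"
proof -
  have S: "VectorSpace.subspace K (A <+>\<^bsub>V\<^esub> B) V" using subspace_set_add[OF A B] .
  have "quot_image V B (A <+>\<^bsub>V\<^esub> B) = quot_image V B A"
    unfolding quot_image_eq[OF B subspaceD(1)[OF S]] by (simp only: quot_image_def)
  moreover have "(A <+>\<^bsub>V\<^esub> B) \<inter> B = B" using subset_set_add[OF A B] by auto
  ultimately show ?thesis
    using sdim_quot_image[OF B S] sdim_quot_image[OF B A] by simp
qed

end

section \<open>Bilinear forms and one-sided orthogonal complements\<close>

locale bilinear_space = vectorspace K V for K and V +
  fixes f
  assumes bilinear: "bilinear_form K V f"
begin

lemma form_closed [simp]: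
  "x \<in> carrier V \<Longrightarrow> y \<in> carrier V \<Longrightarrow> f x y \<in> carrier K"
  using bilinear by (auto simp: bilinear_form_def)

lemma form_add:
  assumes "x \<in> carrier V" "y \<in> carrier V" "z \<in> carrier V"
  shows "f (x \<oplus>\<^bsub>V\<^esub> y) z = f x z \<oplus>\<^bsub>K\<^esub> f y z"
    and "f z (x \<oplus>\<^bsub>V\<^esub> y) = f z x \<oplus>\<^bsub>K\<^esub> f z y"
  using bilinear assms by (auto simp: bilinear_form_def)

lemma form_smult:
  assumes "c \<in> carrier K" "x \<in> carrier V" "y \<in> carrier V"
  shows "f (c \<odot>\<^bsub>V\<^esub> x) y = c \<otimes>\<^bsub>K\<^esub> f x y"
    and "f x (c \<odot>\<^bsub>V\<^esub> y) = c \<otimes>\<^bsub>K\<^esub> f x y"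
  using bilinear assms by (auto simp: bilinear_form_def)

lemma bilinear_flip: "bilinear_form K V (\<lambda>x y. f y x)"
  using bilinear by (auto simp: bilinear_form_def)

lemma form_zero:
  assumes "x \<in> carrier V"
  shows "f \<zero>\<^bsub>V\<^esub> x = \<zero>\<^bsub>K\<^esub>" "f x \<zero>\<^bsub>V\<^esub> = \<zero>\<^bsub>K\<^esub>"
  using form_smult[of "\<zero>\<^bsub>K\<^esub>" "\<zero>\<^bsub>V\<^esub>" x] form_smult[of "\<zero>\<^bsub>K\<^esub>" x "\<zero>\<^bsub>V\<^esub>"] assms by auto

lemma form_minus:
  assumes "x \<in> carrier V" "y \<in> carrier V" "z \<in> carrier V"
  shows "f (x \<ominus>\<^bsub>V\<^esub> y) z = f x z \<ominus>\<^bsub>K\<^esub> f y z"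
    and "f z (x \<ominus>\<^bsub>V\<^esub> y) = f z x \<ominus>\<^bsub>K\<^esub> f z y"
proof -
  have n: "\<ominus>\<^bsub>V\<^esub> y = (\<ominus>\<^bsub>K\<^esub> \<one>\<^bsub>K\<^esub>) \<odot>\<^bsub>V\<^esub> y" using assms by (simp add: smult_minus_1)
  have l: "(\<ominus>\<^bsub>K\<^esub> \<one>\<^bsub>K\<^esub>) \<otimes>\<^bsub>K\<^esub> c = \<ominus>\<^bsub>K\<^esub> c" if "c \<in> carrier K" for c
    using that by (simp add: R.l_minus)
  show "f (x \<ominus>\<^bsub>V\<^esub> y) z = f x z \<ominus>\<^bsub>K\<^esub> f y z"
    using assms form_add(1)[of x "(\<ominus>\<^bsub>K\<^esub> \<one>\<^bsub>K\<^esub>) \<odot>\<^bsub>V\<^esub> y" z] form_smult(1)[of "\<ominus>\<^bsub>K\<^esub> \<one>\<^bsub>K\<^esub>" y z]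
    by (simp only: a_minus_def n l) (simp add: l)
  show "f z (x \<ominus>\<^bsub>V\<^esub> y) = f z x \<ominus>\<^bsub>K\<^esub> f z y"
    using assms form_add(2)[of x "(\<ominus>\<^bsub>K\<^esub> \<one>\<^bsub>K\<^esub>) \<odot>\<^bsub>V\<^esub> y" z] form_smult(2)[of "\<ominus>\<^bsub>K\<^esub> \<one>\<^bsub>K\<^esub>" z y]
    by (simp only: a_minus_def n l) (simp add: l)
qed

lemma form_eq_iff:
  assumes "x \<in> carrier V" "y \<in> carrier V" "z \<in> carrier V"
  shows "f x z = f y z \<longleftrightarrow> f (x \<ominus>\<^bsub>V\<^esub> y) z = \<zero>\<^bsub>K\<^esub>"
    and "f z x = f z y \<longleftrightarrow> f z (x \<ominus>\<^bsub>V\<^esub> y) = \<zero>\<^bsub>K\<^esub>"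
  using assms by (simp_all add: form_minus R.r_right_minus_eq)

lemma form_lincomb:
  assumes "finite B" "B \<subseteq> carrier V" "a \<in> B \<rightarrow> carrier K" "y \<in> carrier V"
  shows "f (lincomb a B) y = (\<Oplus>\<^bsub>K\<^esub>b\<in>B. a b \<otimes>\<^bsub>K\<^esub> f b y)"
  using assms
proof (induction B rule: finite_induct)
  case empty
  then show ?case by (simp add: lincomb_def form_zero)
next
  case (insert b B)
  have c: "b \<in> carrier V" "a b \<in> carrier K" "B \<subseteq> carrier V" "a \<in> B \<rightarrow> carrier K"
    using insert.prems by auto
  have fin: "(\<lambda>b. a b \<otimes>\<^bsub>K\<^esub> f b y) \<in> B \<rightarrow> carrier K" using c insert.prems by (auto simp: subset_iff Pi_iff)
  have "lincomb a (insert b B) = a b \<odot>\<^bsub>V\<^esub> b \<oplus>\<^bsub>V\<^esub> lincomb a B"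
    using insert.hyps insert.prems c by (intro lincomb_insert2) auto
  then show ?case
    using insert c fin by (simp add: form_add form_smult lincomb_closed R.finsum_insert)
qed

lemma subspace_left_kernel:
  assumes "y \<in> carrier V"
  shows "VectorSpace.subspace K {x \<in> carrier V. f x y = \<zero>\<^bsub>K\<^esub>} V"
  using assms by (intro subspaceI) (auto simp: form_zero form_add form_smult)

lemma subspace_right_kernel:
  assumes "x \<in> carrier V"
  shows "VectorSpace.subspace K {y \<in> carrier V. f x y = \<zero>\<^bsub>K\<^esub>} V"
  using assms by (intro subspaceI) (auto simp: form_zero form_add form_smult)

lemma subspace_orth:
  assumes "A \<subseteq> carrier V"
  shows "VectorSpace.subspace K (orth K V f A) V"
  using assms by (intro subspaceI) (auto simp: orth_def form_zero form_add form_smult subset_iff)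

lemma orth_span:
  assumes "A \<subseteq> carrier V"
  shows "orth K V f (span A) = orth K V f A"
proof
  show "orth K V f (span A) \<subseteq> orth K V f A"
    using in_own_span[OF assms] by (auto simp: orth_def)
  show "orth K V f A \<subseteq> orth K V f (span A)"
  proof
    fix v assume v: "v \<in> orth K V f A"
    \<comment> \<open>The right arguments killed by \<open>v\<close> form a subspace, so containing
      \<open>A\<close> it contains the span of \<open>A\<close>.\<close>
    then have "span A \<subseteq> {y \<in> carrier V. f v y = \<zero>\<^bsub>K\<^esub>}"
      using assms by (intro span_subset_subspace subspace_right_kernel) (auto simp: orth_def)
    then show "v \<in> orth K V f (span A)" using v by (auto simp: orth_def)
  qed
qed

lemma orth_set_add:
  assumes A: "VectorSpace.subspace K A V" and B: "VectorSpace.subspace K B V"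
  shows "orth K V f (A <+>\<^bsub>V\<^esub> B) = orth K V f A \<inter> orth K V f B"
proof
  show "orth K V f (A <+>\<^bsub>V\<^esub> B) \<subseteq> orth K V f A \<inter> orth K V f B"
    using subset_set_add[OF A B] by (auto simp: orth_def)
  have "f v (a \<oplus>\<^bsub>V\<^esub> b) = \<zero>\<^bsub>K\<^esub>"
    if "v \<in> carrier V" "a \<in> A" "b \<in> B" "f v a = \<zero>\<^bsub>K\<^esub>" "f v b = \<zero>\<^bsub>K\<^esub>" for v a b
    using that subspaceD(1)[OF A] subspaceD(1)[OF B] by (auto simp: form_add subset_iff)
  then show "orth K V f A \<inter> orth K V f B \<subseteq> orth K V f (A <+>\<^bsub>V\<^esub> B)"
    by (auto simp: orth_def set_add_iff)
qed

end

section \<open>Nondegenerate forms: dimension of complements and dual vectors\<close>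

locale finite_nondegenerate_space = finite_vectorspace K V + bilinear_space K V f for K V f +
  assumes nondegenerate: "nondegenerate_form K V f"
begin

lemma nondegenerate_left:
  assumes "x \<in> carrier V" "\<And>y. y \<in> carrier V \<Longrightarrow> f x y = \<zero>\<^bsub>K\<^esub>"
  shows "x = \<zero>\<^bsub>V\<^esub>"
  using nondegenerate assms by (auto simp: nondegenerate_form_def)

lemma nondegenerate_right:
  assumes "y \<in> carrier V" "\<And>x. x \<in> carrier V \<Longrightarrow> f x y = \<zero>\<^bsub>K\<^esub>"
  shows "y = \<zero>\<^bsub>V\<^esub>"
  using nondegenerate assms by (auto simp: nondegenerate_form_def)

text \<open>The form need not be symmetric and \<open>orth\<close> constrains only its left
  argument; the swapped form makes results about left arguments available for right ones.\<close>

lemma nondegenerate_flip: "finite_nondegenerate_space K V (\<lambda>x y. f y x)"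
  using finite_vectorspace_axioms vectorspace_axioms bilinear_flip nondegenerate
  by (auto simp: finite_nondegenerate_space_def finite_nondegenerate_space_axioms_def
      bilinear_space_def bilinear_space_axioms_def nondegenerate_form_def)

lemma card_form_image_le:
  assumes "finite B" "B \<subseteq> carrier V" "A \<subseteq> carrier V"
  shows "card ((\<lambda>v. \<lambda>b\<in>B. f v b) ` A) \<le> card (carrier K) ^ card B"
proof -
  have "card ((\<lambda>v. \<lambda>b\<in>B. f v b) ` A) \<le> card (B \<rightarrow>\<^sub>E carrier K)"
    using assms finite_field by (intro card_mono finite_PiE) (auto simp: subset_iff)
  then show ?thesis using assms by (simp add: card_PiE)
qed

text \<open>Orthogonality to \<open>A\<close> is orthogonality to a basis of \<open>A\<close>. Hence
  the complement is the kernel of evaluation at \<open>dim A\<close> vectors, and that evaluation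
  has at most \<open>card (carrier K)\<close> to the power \<open>dim A\<close> values.\<close>

lemma dim_le_sdim_orth:
  assumes A: "VectorSpace.subspace K A V"
  shows "dim \<le> sdim K V (orth K V f A) + sdim K V A"
proof -
  obtain B where B: "finite B" "B \<subseteq> A" "span B = A" "card B = sdim K V A"
    using subspace_basis[OF A] by metis
  have AV: "A \<subseteq> carrier V" using subspaceD(1)[OF A] .
  then have BV: "B \<subseteq> carrier V" using B by auto
  have O: "VectorSpace.subspace K (orth K V f A) V" using subspace_orth[OF AV] .
  have orth: "orth K V f A = orth K V f B" using orth_span[OF BV] B(3) by simp
  let ?h = "\<lambda>v. \<lambda>b\<in>B. f v b"
  have ker: "?h x = ?h y \<longleftrightarrow> x \<ominus>\<^bsub>V\<^esub> y \<in> orth K V f A" if "x \<in> carrier V" "y \<in> carrier V" for x y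
  proof -
    have "?h x = ?h y \<longleftrightarrow> (\<forall>b\<in>B. f x b = f y b)"
      by (auto simp: fun_eq_iff restrict_def)
    also have "\<dots> \<longleftrightarrow> (\<forall>b\<in>B. f (x \<ominus>\<^bsub>V\<^esub> y) b = \<zero>\<^bsub>K\<^esub>)"
      using form_eq_iff(1) that BV by blast
    finally show ?thesis using that unfolding orth by (simp add: orth_def)
  qed
  have "card (carrier V) = card (?h ` carrier V) * card (carrier V \<inter> orth K V f A)"
    using subspace_additive_subgroup[OF subspace_carrier] finite_space ker
    by (rule M.card_eq_card_image_times_card_kernel)
  also have "carrier V \<inter> orth K V f A = orth K V f A" by (auto simp: orth_def)
  also have "card (?h ` carrier V) * card (orth K V f A)
      \<le> card (carrier K) ^ sdim K V A * card (carrier K) ^ sdim K V (orth K V f A)"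
    using card_form_image_le[OF B(1) BV subset_refl] card_subspace[OF O] B(4) by simp
  finally have "card (carrier K) ^ dim \<le> card (carrier K) ^ (sdim K V A + sdim K V (orth K V f A))"
    unfolding card_carrier_eq(2)[OF fin_dim finite_field] power_add .
  then show ?thesis using card_field_gt_1 by simp
qed

text \<open>A basis \<open>B\<close> of the complement is enlarged by a set \<open>C\<close> of at
  most \<open>dim - card B\<close> vectors to a generating set of \<open>V\<close>. A vector of
  \<open>A\<close> paired to zero with \<open>C\<close> is also paired to zero with
  \<open>B\<close>, hence with \<open>V\<close>, and vanishes. So \<open>A\<close> embeds into the
  families of scalars indexed by \<open>C\<close>.\<close>

lemma sdim_orth_le:
  assumes A: "VectorSpace.subspace K A V"
  shows "sdim K V (orth K V f A) + sdim K V A \<le> dim"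
proof -
  have AV: "A \<subseteq> carrier V" using subspaceD(1)[OF A] .
  have O: "VectorSpace.subspace K (orth K V f A) V" using subspace_orth[OF AV] .
  obtain B where B: "finite B" "B \<subseteq> orth K V f A" "lin_indpt B" "card B = sdim K V (orth K V f A)"
    using subspace_basis[OF O] by metis
  obtain D where D: "finite D" "D \<subseteq> carrier V" "span D = carrier V" "card D = dim"
    using subspace_basis[OF subspace_carrier] sdim_carrier by metis
  have BV: "B \<subseteq> carrier V" using B subspaceD(1)[OF O] by auto
  then have "B \<subseteq> span D" using D by simp
  then obtain C where C: "finite C" "C \<subseteq> carrier V" "int (card C) \<le> int (card D) - int (card B)"
    "span (B \<union> C) = span D"
    using replacement[OF B(1) D(1,2) B(3)] by metis
  interpret flip: finite_nondegenerate_space K V "\<lambda>x y. f y x" by (rule nondegenerate_flip)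
  let ?h = "\<lambda>a. \<lambda>c\<in>C. f c a"
  have "inj_on ?h A"
  proof (rule inj_onI)
    fix x y assume xy: "x \<in> A" "y \<in> A" and eq: "?h x = ?h y"
    let ?z = "x \<ominus>\<^bsub>V\<^esub> y"
    have z: "?z \<in> A" using subspaceD(6)[OF A] xy by simp
    have xyV: "x \<in> carrier V" "y \<in> carrier V" and zV: "?z \<in> carrier V" using xy z AV by auto
    have "f c x = f c y" if "c \<in> C" for c using fun_cong[OF eq, of c] that by simp
    then have "\<forall>c\<in>C. f c ?z = \<zero>\<^bsub>K\<^esub>" using form_eq_iff(2) xyV C(2) by blast
    moreover have "\<forall>b\<in>B. f b ?z = \<zero>\<^bsub>K\<^esub>" using B(2) z by (auto simp: orth_def)
    ultimately have "span (B \<union> C) \<subseteq> {v \<in> carrier V. f v ?z = \<zero>\<^bsub>K\<^esub>}"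
      using BV C(2) by (intro span_subset_subspace subspace_left_kernel zV) auto
    then have "?z = \<zero>\<^bsub>V\<^esub>"
      using C(4) D(3) zV by (intro nondegenerate_right) auto
    then show "x = y" using xyV by (metis M.add.inv_solve_right' M.l_zero M.zero_closed a_minus_def)
  qed
  then have "card A \<le> card (carrier K) ^ card C"
    using flip.card_form_image_le[OF C(1,2) AV] card_image by metis
  then have "sdim K V A \<le> card C" using card_subspace[OF A] card_field_gt_1 by simp
  then show ?thesis using C(3) B(4) D(4) by simp
qed

lemma sdim_orth:
  assumes "VectorSpace.subspace K A V"
  shows "sdim K V (orth K V f A) + sdim K V A = dim"
  using dim_le_sdim_orth[OF assms] sdim_orth_le[OF assms] by simp

text \<open>Pairing with the generating set \<open>B\<close> is injective by nondegeneracy. Since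
  \<open>card B = dim\<close>, source and target have equally many elements, so every family of
  values on \<open>B\<close> is attained, in particular the indicator of \<open>c\<close>.\<close>

lemma dual_vector_exists:
  assumes B: "finite B" "B \<subseteq> carrier V" "span B = carrier V" "card B = dim" and c: "c \<in> B"
  shows "\<exists>w\<in>carrier V. \<forall>b\<in>B. f b w = (if b = c then \<one>\<^bsub>K\<^esub> else \<zero>\<^bsub>K\<^esub>)"
proof -
  let ?h = "\<lambda>w. \<lambda>b\<in>B. f b w"
  have "inj_on ?h (carrier V)"
  proof (rule inj_onI)
    fix x y assume xy: "x \<in> carrier V" "y \<in> carrier V" and eq: "?h x = ?h y"
    have "f b x = f b y" if "b \<in> B" for b using fun_cong[OF eq, of b] that by simp
    then have "B \<subseteq> {v \<in> carrier V. f v (x \<ominus>\<^bsub>V\<^esub> y) = \<zero>\<^bsub>K\<^esub>}"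
      using form_eq_iff(2) xy B(2) by blast
    then have "span B \<subseteq> {v \<in> carrier V. f v (x \<ominus>\<^bsub>V\<^esub> y) = \<zero>\<^bsub>K\<^esub>}"
      using xy by (intro span_subset_subspace subspace_left_kernel) auto
    then have "x \<ominus>\<^bsub>V\<^esub> y = \<zero>\<^bsub>V\<^esub>"
      using B(3) xy by (intro nondegenerate_right) auto
    then show "x = y" using xy by (metis M.add.inv_solve_right' M.l_zero M.zero_closed a_minus_def)
  qed
  then have "card (?h ` carrier V) = card (B \<rightarrow>\<^sub>E carrier K)"
    using card_carrier_eq(2)[OF fin_dim finite_field] B(1,4) by (simp add: card_image card_PiE)
  moreover have "?h ` carrier V \<subseteq> B \<rightarrow>\<^sub>E carrier K" using B(2) by auto
  moreover have "finite (B \<rightarrow>\<^sub>E carrier K)" using B(1) finite_field by (intro finite_PiE) auto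
  ultimately have surj: "?h ` carrier V = B \<rightarrow>\<^sub>E carrier K" by (intro card_subset_eq)
  have "(\<lambda>b\<in>B. if b = c then \<one>\<^bsub>K\<^esub> else \<zero>\<^bsub>K\<^esub>) \<in> ?h ` carrier V" unfolding surj by auto
  then obtain w where w: "w \<in> carrier V" and eq: "(\<lambda>b\<in>B. if b = c then \<one>\<^bsub>K\<^esub> else \<zero>\<^bsub>K\<^esub>) = ?h w"
    by blast
  have "f b w = (if b = c then \<one>\<^bsub>K\<^esub> else \<zero>\<^bsub>K\<^esub>)" if "b \<in> B" for b
    using fun_cong[OF eq, of b] that by simp
  then show ?thesis using w by blast
qed

end

section \<open>Restriction of scalars, and passage from \<open>W\<close> to \<open>V\<close>\<close>

lemma vectorspace_restrict_scalars:
  assumes "vectorspace F V" "subfield K F"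
  shows "vectorspace (F\<lparr>carrier := K\<rparr>) V"
proof -
  interpret vectorspace F V by fact
  have field: "field (F\<lparr>carrier := K\<rparr>)" using assms(2) by (rule R.subfield_iff(2))
  have "K \<subseteq> carrier F" using assms(2) by (rule subfieldE(3))
  then have sub: "\<And>c. c \<in> K \<Longrightarrow> c \<in> carrier F" by auto
  interpret k: field "F\<lparr>carrier := K\<rparr>" by (rule field)
  have "Module.module (F\<lparr>carrier := K\<rparr>) V"
    by (rule moduleI)
      (use k.cring_axioms M.abelian_group_axioms in
        \<open>auto simp: sub smult_l_distr smult_r_distr smult_assoc1\<close>)
  then show ?thesis using field by (rule vectorspace.intro)
qed

lemma subspace_restrict_scalars:
  assumes "VectorSpace.subspace F A V" "subfield K F"
  shows "VectorSpace.subspace (F\<lparr>carrier := K\<rparr>) A V"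
proof -
  interpret vectorspace F V using assms(1) by (simp add: VectorSpace.subspace_def)
  interpret k: vectorspace "F\<lparr>carrier := K\<rparr>" V
    using vectorspace_axioms assms(2) by (rule vectorspace_restrict_scalars)
  have "K \<subseteq> carrier F" using assms(2) by (rule subfieldE(3))
  then show ?thesis using subspaceD[OF assms(1)] by (intro k.subspaceI) auto
qed

text \<open>One form plays both roles: over \<open>K\<close> it is read on \<open>W\<close>, over
  \<open>F\<close> on \<open>V\<close>. That its values on \<open>W\<close> lie in \<open>K\<close>
  is part of \<open>bilinear_W\<close>, through the carrier of the restricted field.\<close>

locale extended_form = finite_vectorspace F V + bilinear_space F V \<sigma> for F V \<sigma> +
  fixes K W
  assumes subfield: "subfield K F"
    and W_subspace: "VectorSpace.subspace (F\<lparr>carrier := K\<rparr>) W V"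
    and sdim_W: "sdim (F\<lparr>carrier := K\<rparr>) V W = dim"
    and span_W: "span W = carrier V"
    and bilinear_W: "bilinear_form (F\<lparr>carrier := K\<rparr>) (V\<lparr>carrier := W\<rparr>) \<sigma>"
    and reflexive_W: "reflexive_form (F\<lparr>carrier := K\<rparr>) (V\<lparr>carrier := W\<rparr>) \<sigma>"
    and nondegenerate_W: "nondegenerate_form (F\<lparr>carrier := K\<rparr>) (V\<lparr>carrier := W\<rparr>) \<sigma>"
begin

abbreviation Fq where "Fq \<equiv> F\<lparr>carrier := K\<rparr>"

lemma K_subset: "K \<subseteq> carrier F"
  using subfield by (rule subfieldE(3))

lemma finite_vectorspace_Fq: "finite_vectorspace Fq V"
  using vectorspace_restrict_scalars[OF vectorspace_axioms subfield] finite_space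
    finite_subset[OF K_subset finite_field]
  by (simp add: finite_vectorspace_def finite_vectorspace_axioms_def)

lemma nondegenerate_space_W: "finite_nondegenerate_space Fq (vs W) \<sigma>"
proof -
  interpret VK: finite_vectorspace Fq V by (rule finite_vectorspace_Fq)
  interpret WK: finite_vectorspace Fq "vs W"
    using W_subspace by (rule VK.finite_vectorspace_subspace)
  show ?thesis
    using bilinear_W nondegenerate_W by unfold_locales
qed

lemma W_carrier: "W \<subseteq> carrier V"
proof -
  interpret VK: finite_vectorspace Fq V by (rule finite_vectorspace_Fq)
  show ?thesis using VK.subspaceD(1)[OF W_subspace] .
qed

lemma subspace_in_W_iff:
  "VectorSpace.subspace Fq S (vs W) \<longleftrightarrow> VectorSpace.subspace Fq S V \<and> S \<subseteq> W"
proof -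
  interpret VK: finite_vectorspace Fq V by (rule finite_vectorspace_Fq)
  interpret WK: finite_nondegenerate_space Fq "vs W" \<sigma> by (rule nondegenerate_space_W)
  show ?thesis
  proof
    assume S: "VectorSpace.subspace Fq S (vs W)"
    show "VectorSpace.subspace Fq S V \<and> S \<subseteq> W"
      using WK.subspaceD[OF S] W_carrier by (intro conjI VK.subspaceI) auto
  next
    assume S: "VectorSpace.subspace Fq S V \<and> S \<subseteq> W"
    then show "VectorSpace.subspace Fq S (vs W)"
      using VK.subspaceD[of S] by (intro WK.subspaceI) auto
  qed
qed

text \<open>An \<open>F\<close>-span is closed under scalars from \<open>K\<close>, so it is one of
  the \<open>K\<close>-subspaces containing \<open>A\<close>.\<close>

lemma lspan_Fq_subset_span:
  assumes "A \<subseteq> carrier V"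
  shows "lspan Fq V A \<subseteq> span A"
proof -
  interpret VK: finite_vectorspace Fq V by (rule finite_vectorspace_Fq)
  show ?thesis
    using subspace_restrict_scalars[OF span_is_subspace[OF assms] subfield] in_own_span[OF assms]
    by (rule VK.span_subset_subspace)
qed

text \<open>The \<open>F\<close>-span of \<open>A\<close> contains its \<open>K\<close>-span
  \<open>W\<close>, and \<open>W\<close> generates \<open>V\<close> over \<open>F\<close>.\<close>

lemma span_eq_carrier:
  assumes "lspan Fq V A = W" "A \<subseteq> W"
  shows "span A = carrier V"
proof
  have AV: "A \<subseteq> carrier V" using assms W_carrier by auto
  then show "span A \<subseteq> carrier V" by (rule span_is_subset2)
  have "W \<subseteq> span A" using lspan_Fq_subset_span[OF AV] assms by simp
  then show "carrier V \<subseteq> span A"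
    using span_subset_subspace[OF span_is_subspace[OF AV], of W] span_W by simp
qed

text \<open>A \<open>K\<close>-basis of \<open>S\<close> extends to one of \<open>W\<close>, which generates \<open>V\<close> over \<open>F\<close> and has
  \<open>dim V\<close> elements, hence is independent over \<open>F\<close>.\<close>

lemma sdim_span:
  assumes S: "VectorSpace.subspace Fq S V" and SW: "S \<subseteq> W"
  shows "sdim F V (span S) = sdim Fq V S"
proof -
  interpret VK: finite_vectorspace Fq V by (rule finite_vectorspace_Fq)
  obtain B where B: "finite B" "B \<subseteq> S" "VK.lin_indpt B" "VK.span B = S" "card B = sdim Fq V S"
    using VK.subspace_basis[OF S] by metis
  obtain D where D: "finite D" "D \<subseteq> W" "VK.span D = W" "card D = dim"
    using VK.subspace_basis[OF W_subspace] sdim_W by metis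
  have DV: "D \<subseteq> carrier V" and SV: "S \<subseteq> carrier V" and BV: "B \<subseteq> carrier V"
    using D SW B W_carrier by auto
  have "B \<subseteq> VK.span D" using B SW D by auto
  then obtain C where C: "finite C" "C \<subseteq> VK.span D" "int (card C) \<le> int (card D) - int (card B)"
    "VK.span (B \<union> C) = VK.span D"
    using VK.replacement[OF B(1) D(1) DV B(3)] by metis
  have BCW: "B \<union> C \<subseteq> W" using B SW C D by auto
  have "card (B \<union> C) \<le> dim" using card_Un_le[of B C] C(3) D(4) by simp
  then have "basis (B \<union> C)"
    using B(1) C BCW W_carrier D(3) by (intro dim_gen_is_basis span_eq_carrier) auto
  then have li: "lin_indpt B" using subset_li_is_li[of "B \<union> C" B] by (simp add: basis_def)
  have sub: "VectorSpace.subspace F (span B) V" using BV by (rule span_is_subspace)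
  have "span S = span B"
  proof
    show "span S \<subseteq> span B"
      using lspan_Fq_subset_span[OF BV] B(4) by (intro span_subset_subspace[OF sub]) simp
    show "span B \<subseteq> span S" using B(2) by (rule span_is_monotone)
  qed
  moreover interpret P: vectorspace F "vs (span B)" using sub by (rule subspace_is_vs)
  have "P.basis B"
    using span_li_not_depend[OF in_own_span[OF BV] is_module[OF sub]] li in_own_span[OF BV]
    by (simp add: P.basis_def)
  then have "sdim F V (span B) = card B" using B(1) by (intro P.dim_basis)
  ultimately show ?thesis using B(5) by simp
qed

text \<open>All conditions on the form are stable under swapping its arguments. This reduces the
  right half of nondegeneracy over \<open>F\<close> to the left half.\<close>

lemma extended_form_flip: "extended_form F V (\<lambda>x y. \<sigma> y x) K W"
proof -
  interpret WK: finite_nondegenerate_space Fq "vs W" \<sigma> by (rule nondegenerate_space_W)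
  interpret flip: finite_nondegenerate_space Fq "vs W" "\<lambda>x y. \<sigma> y x" by (rule WK.nondegenerate_flip)
  have refl: "reflexive_form Fq (vs W) (\<lambda>x y. \<sigma> y x)"
    using reflexive_W unfolding reflexive_form_def by blast
  show ?thesis
    by (intro extended_form.intro bilinear_space.intro extended_form_axioms.intro
        bilinear_space_axioms.intro finite_vectorspace_axioms vectorspace_axioms)
      (fact bilinear_flip flip.bilinear flip.nondegenerate subfield W_subspace sdim_W span_W refl)+
qed

text \<open>A \<open>K\<close>-basis \<open>B\<close> of \<open>W\<close> generates \<open>V\<close>
  over \<open>F\<close>, so \<open>x\<close> has coordinates in \<open>F\<close> with respect to
  \<open>B\<close>. Nondegeneracy on \<open>W\<close> supplies dual vectors inside \<open>W\<close>;
  pairing \<open>x\<close> with the one dual to \<open>c\<close> isolates the coordinate at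
  \<open>c\<close>, which must be zero.\<close>

lemma nondegenerate_left:
  assumes x: "x \<in> carrier V" and orth: "\<And>w. w \<in> W \<Longrightarrow> \<sigma> x w = \<zero>\<^bsub>F\<^esub>"
  shows "x = \<zero>\<^bsub>V\<^esub>"
proof -
  interpret WK: finite_nondegenerate_space Fq "vs W" \<sigma> by (rule nondegenerate_space_W)
  interpret VK: finite_vectorspace Fq V by (rule finite_vectorspace_Fq)
  obtain B where B: "finite B" "B \<subseteq> W" "WK.span B = W" "VK.span B = W" "card B = dim"
    using VK.subspace_basis[OF W_subspace] sdim_W
      VK.span_li_not_depend(1)[OF _ VK.is_module[OF W_subspace]] by metis
  have BV: "B \<subseteq> carrier V" using B W_carrier by auto
  have "span B = carrier V" using B(4,2) by (rule span_eq_carrier)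
  then obtain a where a: "a \<in> B \<rightarrow> carrier F" "lincomb a B = x"
    using finite_in_span[OF B(1) BV] x by auto
  have "a c = \<zero>\<^bsub>F\<^esub>" if c: "c \<in> B" for c
  proof -
    obtain w where w: "w \<in> W" "\<forall>b\<in>B. \<sigma> b w = (if b = c then \<one>\<^bsub>F\<^esub> else \<zero>\<^bsub>F\<^esub>)"
      using WK.dual_vector_exists[OF B(1) _ _ _ c] B sdim_W by auto
    have "\<zero>\<^bsub>F\<^esub> = \<sigma> (lincomb a B) w" using orth w a by simp
    also have "\<dots> = (\<Oplus>\<^bsub>F\<^esub>b\<in>B. a b \<otimes>\<^bsub>F\<^esub> \<sigma> b w)"
      using B(1) BV a w W_carrier by (intro form_lincomb) auto
    also have "\<dots> = (\<Oplus>\<^bsub>F\<^esub>b\<in>B. if c = b then a b else \<zero>\<^bsub>F\<^esub>)"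
      using a w by (intro R.finsum_cong') (auto simp: Pi_iff)
    also have "\<dots> = a c" using a c B(1) by (intro R.finsum_singleton) auto
    finally show ?thesis by simp
  qed
  then have "lincomb a B = \<zero>\<^bsub>V\<^esub>" using BV by (intro lincomb_zero) auto
  then show ?thesis using a by simp
qed

lemma nondegenerate_space: "finite_nondegenerate_space F V \<sigma>"
proof -
  interpret flip: extended_form F V "\<lambda>x y. \<sigma> y x" K W by (rule extended_form_flip)
  have "nondegenerate_form F V \<sigma>"
    unfolding nondegenerate_form_def
    using nondegenerate_left flip.nondegenerate_left W_carrier by blast
  then show ?thesis by unfold_locales
qed

text \<open>On \<open>W\<close> the functionals \<open>\<sigma> r \<cdot>\<close> and \<open>\<sigma> \<cdot> r\<close> have the same kernel, so they are proportional,
  and proportionality extends \<open>F\<close>-linearly to \<open>V\<close>.\<close>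

lemma reflexive_extended:
  assumes r: "r \<in> W" and v: "v \<in> carrier V" and rv: "\<sigma> r v = \<zero>\<^bsub>F\<^esub>"
  shows "\<sigma> v r = \<zero>\<^bsub>F\<^esub>"
proof (cases "\<exists>w\<in>W. \<sigma> r w \<noteq> \<zero>\<^bsub>F\<^esub>")
  case False
  have "r = \<zero>\<^bsub>V\<^esub>" using False r W_carrier by (intro nondegenerate_left) auto
  then show ?thesis using v by (simp add: form_zero)
next
  case True
  then obtain u where u: "u \<in> W" "\<sigma> r u \<noteq> \<zero>\<^bsub>F\<^esub>" by auto
  interpret WK: finite_nondegenerate_space Fq "vs W" \<sigma> by (rule nondegenerate_space_W)
  have rV: "r \<in> carrier V" and uV: "u \<in> carrier V" using r u W_carrier by auto
  \<comment> \<open>Proportionality is written by cross-multiplying with the values at the reference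
    vector \<open>u\<close>, which avoids division.\<close>
  let ?E = "{x \<in> carrier V. \<sigma> r u \<otimes>\<^bsub>F\<^esub> \<sigma> x r = \<sigma> u r \<otimes>\<^bsub>F\<^esub> \<sigma> r x}"
  have "W \<subseteq> ?E"
  proof
    fix w assume w: "w \<in> W"
    then have wV: "w \<in> carrier V" using W_carrier by auto
    have K: "\<sigma> r u \<in> K" "\<sigma> r w \<in> K" using WK.form_closed r u w by auto
    \<comment> \<open>The coefficients lie in \<open>K\<close>, so this combination stays in
      \<open>W\<close>, and they are chosen to make \<open>\<sigma> r\<close> vanish on it.
      Reflexivity on \<open>W\<close> then gives the cross-multiplied identity at
      \<open>w\<close>.\<close>
    let ?z = "\<sigma> r u \<odot>\<^bsub>V\<^esub> w \<ominus>\<^bsub>V\<^esub> \<sigma> r w \<odot>\<^bsub>V\<^esub> u"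
    interpret VK: finite_vectorspace Fq V by (rule finite_vectorspace_Fq)
    have zW: "?z \<in> W"
      using VK.subspaceD(4,6)[OF W_subspace] K w u by auto
    have "\<sigma> r ?z = \<zero>\<^bsub>F\<^esub>"
      using rV uV wV by (simp add: form_minus form_smult R.m_comm)
    then have "\<sigma> ?z r = \<zero>\<^bsub>F\<^esub>" using reflexive_W zW r by (auto simp: reflexive_form_def)
    then have "\<sigma> r u \<otimes>\<^bsub>F\<^esub> \<sigma> w r = \<sigma> r w \<otimes>\<^bsub>F\<^esub> \<sigma> u r"
      using rV uV wV by (simp add: form_minus form_smult)
    then show "w \<in> ?E" using wV rV uV by (simp add: R.m_comm)
  qed
  moreover have "VectorSpace.subspace F ?E V"
  proof (rule subspaceI)
    fix c x assume c: "c \<in> carrier F" and x: "x \<in> ?E"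
    have "\<sigma> r u \<otimes>\<^bsub>F\<^esub> (c \<otimes>\<^bsub>F\<^esub> \<sigma> x r) = c \<otimes>\<^bsub>F\<^esub> (\<sigma> r u \<otimes>\<^bsub>F\<^esub> \<sigma> x r)"
      using c x rV uV by (intro R.m_lcomm) auto
    also have "\<dots> = c \<otimes>\<^bsub>F\<^esub> (\<sigma> u r \<otimes>\<^bsub>F\<^esub> \<sigma> r x)" using x by simp
    also have "\<dots> = \<sigma> u r \<otimes>\<^bsub>F\<^esub> (c \<otimes>\<^bsub>F\<^esub> \<sigma> r x)"
      using c x rV uV by (intro R.m_lcomm) auto
    finally show "c \<odot>\<^bsub>V\<^esub> x \<in> ?E" using c x rV by (simp add: form_smult)
  qed (use rV uV in \<open>auto simp: form_zero form_add R.r_distr\<close>)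
  ultimately have "carrier V \<subseteq> ?E" using span_subset_subspace span_W by metis
  then have "\<sigma> r u \<otimes>\<^bsub>F\<^esub> \<sigma> v r = \<sigma> u r \<otimes>\<^bsub>F\<^esub> \<sigma> r v" using v by blast
  then have "\<sigma> r u \<otimes>\<^bsub>F\<^esub> \<sigma> v r = \<zero>\<^bsub>F\<^esub>" using rv rV uV by simp
  then show ?thesis using u rV uV v integral form_closed by metis
qed

abbreviation perp_W where "perp_W S \<equiv> orth Fq (vs W) \<sigma> S"

lemma perp_W_subspace:
  assumes "S \<subseteq> W"
  shows "VectorSpace.subspace Fq (perp_W S) V" "perp_W S \<subseteq> W"
proof -
  interpret WK: finite_nondegenerate_space Fq "vs W" \<sigma> by (rule nondegenerate_space_W)
  show "VectorSpace.subspace Fq (perp_W S) V" "perp_W S \<subseteq> W"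
    using WK.subspace_orth[of S] assms subspace_in_W_iff by auto
qed

lemma sdim_perp_W:
  assumes "VectorSpace.subspace Fq S V" "S \<subseteq> W"
  shows "sdim Fq V (perp_W S) + sdim Fq V S = dim"
proof -
  interpret WK: finite_nondegenerate_space Fq "vs W" \<sigma> by (rule nondegenerate_space_W)
  show ?thesis using WK.sdim_orth[of S] assms subspace_in_W_iff sdim_W by simp
qed

text \<open>The right side is contained in the left by bilinearity. Both have dimension
  \<open>dim\<close> minus that of \<open>S\<close>: one by the formula over \<open>F\<close>, the
  other by the formula over \<open>K\<close> on \<open>W\<close> followed by
  \<open>sdim_span\<close>.\<close>

lemma orth_span_eq_span_perp_W:
  assumes S: "VectorSpace.subspace Fq S V" and SW: "S \<subseteq> W"
  shows "orth F V \<sigma> (span S) = span (perp_W S)"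
proof -
  interpret N: finite_nondegenerate_space F V \<sigma> by (rule nondegenerate_space)
  note P = perp_W_subspace[OF SW]
  have SV: "S \<subseteq> carrier V" and PV: "perp_W S \<subseteq> carrier V" using SW P W_carrier by auto
  have "perp_W S \<subseteq> orth F V \<sigma> S" using PV by (auto simp: orth_def)
  then have sub: "span (perp_W S) \<subseteq> orth F V \<sigma> (span S)"
    unfolding orth_span[OF SV] by (intro span_subset_subspace subspace_orth SV)
  have "sdim F V (orth F V \<sigma> (span S)) + sdim Fq V S = dim"
    using N.sdim_orth[OF span_is_subspace[OF SV]] sdim_span[OF S SW] by simp
  then have "sdim F V (orth F V \<sigma> (span S)) \<le> sdim F V (span (perp_W S))"
    using sdim_perp_W[OF S SW] sdim_span[OF P] by simp
  then show ?thesis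
    using sdim_eq_imp_eq[OF span_is_subspace[OF PV] _ sub]
      subspace_orth[OF span_is_subset2[OF SV]] by simp
qed

text \<open>Reflexivity puts \<open>S\<close> inside its double complement, and applying the
  dimension formula twice forces equality.\<close>

lemma perp_W_perp_W:
  assumes S: "VectorSpace.subspace Fq S V" and SW: "S \<subseteq> W"
  shows "perp_W (perp_W S) = S"
proof -
  interpret VK: finite_vectorspace Fq V by (rule finite_vectorspace_Fq)
  note P = perp_W_subspace[OF SW]
  note PP = perp_W_subspace[OF P(2)]
  have sub: "S \<subseteq> perp_W (perp_W S)"
    using SW reflexive_W by (auto simp: orth_def reflexive_form_def)
  have "sdim Fq V (perp_W (perp_W S)) \<le> sdim Fq V S"
    using sdim_perp_W[OF S SW] sdim_perp_W[OF P] by simp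
  then show ?thesis using VK.sdim_eq_imp_eq[OF S PP(1) sub] by simp
qed

end

lemma quot_image_mono:
  assumes "A \<subseteq> B"
  shows "quot_image V N A \<subseteq> quot_image V N B"
  using assms unfolding quot_image_def set_add_def' by (intro image_mono UN_mono) auto

section \<open>Weight and defect through preimages in \<open>W\<close>\<close>

context extended_form
begin

text \<open>\<open>N\<close> is kept general because preimages in \<open>W\<close> are needed both
  modulo \<open>\<Gamma>\<close> and modulo its complement.\<close>

context
  fixes N T
  assumes N: "VectorSpace.subspace F N V"
    and T: "VectorSpace.subspace F T (quot_space V N)"
begin

lemma subspace_W_preimage: "VectorSpace.subspace Fq {w \<in> W. N +>\<^bsub>V\<^esub> w \<in> T} V"
proof -
  interpret VK: finite_vectorspace Fq V by (rule finite_vectorspace_Fq)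
  have "{w \<in> W. N +>\<^bsub>V\<^esub> w \<in> T} = W \<inter> {v \<in> carrier V. N +>\<^bsub>V\<^esub> v \<in> T}" using W_carrier by auto
  then show ?thesis
    using VK.subspace_Int[OF W_subspace]
      subspace_restrict_scalars[OF subspace_quot_preimage[OF N T] subfield] by simp
qed

lemma quot_image_W_Int:
  "quot_image V N W \<inter> T = quot_image V N {w \<in> W. N +>\<^bsub>V\<^esub> w \<in> T}"
proof -
  have "{w \<in> W. N +>\<^bsub>V\<^esub> w \<in> T} \<subseteq> carrier V" using W_carrier by auto
  then show ?thesis
    unfolding quot_image_eq[OF N W_carrier] by (subst quot_image_eq[OF N]) auto
qed

text \<open>The span lies in the preimage of \<open>T\<close>, which gives one inclusion. Conversely
  its image is a subspace containing the cosets of vectors of \<open>W\<close> in \<open>T\<close>,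
  and these generate \<open>T\<close>.\<close>

lemma quot_image_span_W_preimage:
  assumes gen: "lspan F (quot_space V N) (T \<inter> quot_image V N W) = T"
  shows "quot_image V N (span {w \<in> W. N +>\<^bsub>V\<^esub> w \<in> T}) = T"
proof -
  interpret Q: vectorspace F "quot_space V N" using N by (rule vectorspace_quot_space)
  let ?S = "{w \<in> W. N +>\<^bsub>V\<^esub> w \<in> T}"
  have SV: "?S \<subseteq> carrier V" using W_carrier by auto
  have sub: "VectorSpace.subspace F (span ?S) V" using SV by (rule span_is_subspace)
  have "span ?S \<subseteq> {v \<in> carrier V. N +>\<^bsub>V\<^esub> v \<in> T}"
    using SV by (intro span_subset_subspace subspace_quot_preimage N T) auto
  then have "quot_image V N (span ?S) \<subseteq> T"
    unfolding quot_image_eq[OF N span_is_subset2[OF SV]] by auto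
  moreover have "T \<inter> quot_image V N W \<subseteq> quot_image V N (span ?S)"
    unfolding Int_commute[of T] quot_image_W_Int
      quot_image_eq[OF N SV] quot_image_eq[OF N span_is_subset2[OF SV]]
    using in_own_span[OF SV] by auto
  then have "lspan F (quot_space V N) (T \<inter> quot_image V N W) \<subseteq> quot_image V N (span ?S)"
    by (rule Q.span_subset_subspace[OF subspace_quot_image[OF N sub]])
  ultimately show ?thesis using gen by simp
qed

text \<open>As \<open>N\<close> meets \<open>W\<close> trivially, the coset map loses no dimension
  on the preimage.\<close>

lemma weight_eq_sdim_W_preimage:
  assumes NW: "N \<inter> W = {\<zero>\<^bsub>V\<^esub>}"
  shows "weight F K (quot_space V N) (quot_image V N W) T = sdim Fq V {w \<in> W. N +>\<^bsub>V\<^esub> w \<in> T}"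
proof -
  interpret VK: finite_vectorspace Fq V by (rule finite_vectorspace_Fq)
  let ?S = "{w \<in> W. N +>\<^bsub>V\<^esub> w \<in> T}"
  have "\<zero>\<^bsub>V\<^esub> \<in> ?S" using VK.subspaceD(2)[OF subspace_W_preimage] .
  then have "?S \<inter> N = {\<zero>\<^bsub>V\<^esub>}" using NW by auto
  then show ?thesis
    using VK.sdim_quot_image[OF subspace_restrict_scalars[OF N subfield] subspace_W_preimage]
      VK.sdim_zero
    by (simp add: weight_def quot_image_W_Int)
qed

text \<open>The weight is the \<open>K\<close>-dimension of the preimage, equal to the
  \<open>F\<close>-dimension of its span; passing from the span to \<open>T\<close> loses exactly
  its intersection with \<open>N\<close>.\<close>

lemma defect_eq_sdim_Int:
  assumes NW: "N \<inter> W = {\<zero>\<^bsub>V\<^esub>}"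
    and gen: "lspan F (quot_space V N) (T \<inter> quot_image V N W) = T"
  shows "defect F K (quot_space V N) (quot_image V N W) T =
    int (sdim F V (span {w \<in> W. N +>\<^bsub>V\<^esub> w \<in> T} \<inter> N))"
proof -
  let ?S = "{w \<in> W. N +>\<^bsub>V\<^esub> w \<in> T}"
  have SW: "?S \<subseteq> W" by auto
  then have "?S \<subseteq> carrier V" using W_carrier by auto
  then have "sdim F (quot_space V N) T + sdim F V (span ?S \<inter> N) = sdim Fq V ?S"
    using sdim_quot_image[OF N span_is_subspace[of ?S]] quot_image_span_W_preimage[OF gen]
      sdim_span[OF subspace_W_preimage SW] by simp
  then show ?thesis unfolding defect_def weight_eq_sdim_W_preimage[OF NW] by simp
qed

end

text \<open>Source of all lower bounds on weights: used with a complement modulo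
  \<open>\<Gamma>p\<close> for the dual, and with a span modulo \<open>\<Gamma>\<close> for the
  bidual.\<close>

lemma sdim_le_weight_quot_image:
  assumes N: "VectorSpace.subspace F N V" and NW: "N \<inter> W = {\<zero>\<^bsub>V\<^esub>}"
    and A: "VectorSpace.subspace F A V"
    and P: "VectorSpace.subspace Fq P V" "P \<subseteq> W" "P \<subseteq> A"
  shows "sdim Fq V P \<le> weight F K (quot_space V N) (quot_image V N W) (quot_image V N A)"
proof -
  interpret VK: finite_vectorspace Fq V by (rule finite_vectorspace_Fq)
  have T: "VectorSpace.subspace F (quot_image V N A) (quot_space V N)"
    using N A by (rule subspace_quot_image)
  have "P \<subseteq> {w \<in> W. N +>\<^bsub>V\<^esub> w \<in> quot_image V N A}"
    using P quot_image_eq[OF N subspaceD(1)[OF A]] by auto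
  then show ?thesis
    unfolding weight_eq_sdim_W_preimage[OF N T NW]
    by (rule VK.sdim_mono[OF P(1) subspace_W_preimage[OF N T]])
qed

section \<open>The dual and the bidual of a subspace\<close>

theorem delsarte_dual_properties:
  fixes \<Gamma> T n k
  defines "\<Gamma>p \<equiv> orth F V \<sigma> \<Gamma>"
    and "Vk \<equiv> quot_space V \<Gamma>"
    and "U \<equiv> quot_image V \<Gamma> W"
  defines "Vnk \<equiv> quot_space V \<Gamma>p"
    and "Ud \<equiv> quot_image V \<Gamma>p W"
    and "d \<equiv> subspace_dual F V \<sigma> W \<Gamma> \<Gamma>p"
    and "d' \<equiv> subspace_dual F V \<sigma> W \<Gamma>p \<Gamma>"
  assumes dim: "dim = n" and k: "k \<le> n"
    and \<Gamma>: "VectorSpace.subspace F \<Gamma> V" "sdim F V \<Gamma> = n - k" "\<Gamma> \<inter> W = {\<zero>\<^bsub>V\<^esub>}"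
    and T: "VectorSpace.subspace F T Vk" "lspan F Vk (T \<inter> U) = T"
  shows "d (carrier Vk) = {\<zero>\<^bsub>Vnk\<^esub>} \<and>
    int (sdim F Vnk (d T)) = int n - int k - defect F K Vk U T \<and>
    (\<Gamma>p \<inter> W = {\<zero>\<^bsub>V\<^esub>} \<longrightarrow>
      int (weight F K Vnk Ud (d T)) \<ge> int n - int (weight F K Vk U T)) \<and>
    (\<Gamma>p \<inter> W = {\<zero>\<^bsub>V\<^esub>} \<longrightarrow>
      defect F K Vnk Ud (d T) \<ge> int k - int (sdim F Vk T)) \<and>
    (d' (d T) \<subseteq> T \<and> defect F K Vk U (d' (d T)) \<ge> defect F K Vk U T) \<and>
    (\<forall>T'. T' \<subseteq> T \<longrightarrow> d T \<subseteq> d T')"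
proof -
  interpret N: finite_nondegenerate_space F V \<sigma> by (rule nondegenerate_space)
  have \<Gamma>V: "\<Gamma> \<subseteq> carrier V" using subspaceD(1)[OF \<Gamma>(1)] .
  have \<Gamma>p: "VectorSpace.subspace F \<Gamma>p V" unfolding \<Gamma>p_def using \<Gamma>V by (rule subspace_orth)

  define S where "S = {w \<in> W. \<Gamma> +>\<^bsub>V\<^esub> w \<in> T}"
  have S: "VectorSpace.subspace Fq S V" "S \<subseteq> W"
    using subspace_W_preimage[OF \<Gamma>(1) T(1)[unfolded Vk_def]] by (auto simp: S_def)
  have SV: "S \<subseteq> carrier V" using S W_carrier by auto
  have spanS: "VectorSpace.subspace F (span S) V" using SV by (rule span_is_subspace)
  have T_eq: "quot_image V \<Gamma> (span S) = T"
    using quot_image_span_W_preimage[OF \<Gamma>(1) T(1)[unfolded Vk_def]] T(2)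
    by (simp add: S_def Vk_def U_def)
  have weight: "weight F K Vk U T = sdim Fq V S"
    using weight_eq_sdim_W_preimage[OF \<Gamma>(1) T(1)[unfolded Vk_def] \<Gamma>(3)]
    by (simp add: S_def Vk_def U_def)
  have defect: "defect F K Vk U T = int (sdim F V (span S \<inter> \<Gamma>))"
    using defect_eq_sdim_Int[OF \<Gamma>(1) T(1)[unfolded Vk_def] \<Gamma>(3)] T(2)
    by (simp add: S_def Vk_def U_def)
  define A where "A = orth F V \<sigma> (span S)"
  have A: "VectorSpace.subspace F A V"
    unfolding A_def using subspaceD(1)[OF spanS] by (rule subspace_orth)
  have dT: "d T = quot_image V \<Gamma>p A" by (simp add: d_def subspace_dual_def S_def A_def)
  have dT_sub: "VectorSpace.subspace F (d T) Vnk"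
    unfolding dT Vnk_def using \<Gamma>p A by (rule subspace_quot_image)
  have A_perp: "A = span (perp_W S)"
    unfolding A_def using S by (intro orth_span_eq_span_perp_W) auto
  have perp_A: "perp_W S \<subseteq> A"
    unfolding A_perp using perp_W_subspace(2)[OF S(2)] W_carrier by (intro in_own_span) auto

  \<comment> \<open>Every vector of \<open>W\<close> has its coset in the full quotient, so the dual
    starts from the complement of all of \<open>V\<close>, which is zero.\<close>
  have 1: "d (carrier Vk) = {\<zero>\<^bsub>Vnk\<^esub>}"
  proof -
    have "{w \<in> W. \<Gamma> +>\<^bsub>V\<^esub> w \<in> carrier Vk} = W"
      using W_carrier by (auto simp: Vk_def quot_space_simps(1)[OF \<Gamma>(1)])
    moreover have "orth F V \<sigma> (carrier V) = {\<zero>\<^bsub>V\<^esub>}"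
      using N.nondegenerate_left by (auto simp: orth_def form_zero)
    ultimately have "d (carrier Vk) = quot_image V \<Gamma>p {\<zero>\<^bsub>V\<^esub>}"
      by (simp add: d_def subspace_dual_def span_W)
    then show ?thesis
      using quot_image_eq[OF \<Gamma>p, of "{\<zero>\<^bsub>V\<^esub>}"] subspaceD(1)[OF \<Gamma>p]
      by (simp add: Vnk_def quot_space_simps(2)[OF \<Gamma>p])
  qed

  have 2: "int (sdim F Vnk (d T)) = int n - int k - defect F K Vk U T"
  proof -
    \<comment> \<open>What \<open>A\<close> loses modulo \<open>\<Gamma>p\<close> is the complement
      of a sum. The dimension formulas for quotient, complement and sum then leave
      \<open>n - k\<close> minus the dimension of \<open>span S \<inter> \<Gamma>\<close>, which is
      the defect.\<close>
    have "A \<inter> \<Gamma>p = orth F V \<sigma> (span S <+>\<^bsub>V\<^esub> \<Gamma>)"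
      unfolding A_def \<Gamma>p_def using orth_set_add[OF spanS \<Gamma>(1)] by simp
    then have "sdim F Vnk (d T) + sdim F V (orth F V \<sigma> (span S <+>\<^bsub>V\<^esub> \<Gamma>)) = sdim F V A"
      using sdim_quot_image[OF \<Gamma>p A] by (simp add: dT Vnk_def)
    moreover have "sdim F V (orth F V \<sigma> (span S <+>\<^bsub>V\<^esub> \<Gamma>)) + sdim F V (span S <+>\<^bsub>V\<^esub> \<Gamma>) = n"
      using N.sdim_orth[OF subspace_set_add[OF spanS \<Gamma>(1)]] dim by simp
    moreover have "sdim F V (span S <+>\<^bsub>V\<^esub> \<Gamma>) + sdim F V (span S \<inter> \<Gamma>) = sdim F V (span S) + (n - k)"
      using sdim_set_add[OF spanS \<Gamma>(1)] \<Gamma>(2) by simp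
    moreover have "sdim F V A + sdim F V (span S) = n"
      using N.sdim_orth[OF spanS] dim by (simp add: A_def)
    ultimately show ?thesis using k defect by linarith
  qed

  \<comment> \<open>The witness is \<open>perp_W S\<close>, of \<open>K\<close>-dimension
    \<open>n\<close> minus the weight of \<open>T\<close>; the condition on \<open>\<Gamma>p\<close>
    makes it embed into the quotient.\<close>
  have 3: "int (weight F K Vnk Ud (d T)) \<ge> int n - int (weight F K Vk U T)"
    if "\<Gamma>p \<inter> W = {\<zero>\<^bsub>V\<^esub>}"
    using sdim_le_weight_quot_image[OF \<Gamma>p that A perp_W_subspace[OF S(2)] perp_A]
      sdim_perp_W[OF S[unfolded]] dim weight
    by (simp add: dT Vnk_def Ud_def)

  \<comment> \<open>Subtracting the dimension in \<open>2\<close> from the bound in \<open>3\<close>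
    cancels \<open>n\<close> and the weight of \<open>T\<close>.\<close>
  have 4: "defect F K Vnk Ud (d T) \<ge> int k - int (sdim F Vk T)" if "\<Gamma>p \<inter> W = {\<zero>\<^bsub>V\<^esub>}"
    using 2 3[OF that] by (simp add: defect_def)

  define R where "R = {w \<in> W. \<Gamma>p +>\<^bsub>V\<^esub> w \<in> d T}"
  have R: "VectorSpace.subspace Fq R V" "R \<subseteq> W"
    using subspace_W_preimage[OF \<Gamma>p dT_sub[unfolded Vnk_def]] by (auto simp: R_def)
  have RV: "R \<subseteq> carrier V" using R W_carrier by auto
  \<comment> \<open>The bidual is the image of the complement of \<open>span R\<close>, and that
    complement is generated by the vectors of \<open>W\<close> orthogonal to
    \<open>R\<close>.\<close>
  define P where "P = perp_W R"
  note P = perp_W_subspace[OF R(2), folded P_def]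
  have PV: "P \<subseteq> carrier V" using P W_carrier by auto
  have spanP: "VectorSpace.subspace F (span P) V" using PV by (rule span_is_subspace)
  have orth_R: "orth F V \<sigma> (span R) = span P"
    unfolding P_def using R by (intro orth_span_eq_span_perp_W) auto
  have ddT: "d' (d T) = quot_image V \<Gamma> (span P)"
    by (simp add: d'_def subspace_dual_def R_def[symmetric] orth_R)
  \<comment> \<open>The inclusion may be proper, as \<open>R\<close> also collects vectors of
    \<open>W\<close> lying in \<open>A\<close> only modulo \<open>\<Gamma>p\<close>. Taking
    complements in \<open>W\<close> reverses it to \<open>P \<subseteq> S\<close>.\<close>
  have "perp_W S \<subseteq> R"
    using perp_A perp_W_subspace(2)[OF S(2)] quot_image_eq[OF \<Gamma>p subspaceD(1)[OF A]]
    by (auto simp: R_def dT)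
  then have "P \<subseteq> perp_W (perp_W S)" by (auto simp: P_def orth_def)
  then have "P \<subseteq> S" using perp_W_perp_W[OF S[unfolded]] by simp
  then have "span P \<subseteq> span S" by (rule span_is_monotone)
  then have "quot_image V \<Gamma> (span P) \<subseteq> quot_image V \<Gamma> (span S)" by (rule quot_image_mono)
  then have 5: "d' (d T) \<subseteq> T" by (simp add: ddT T_eq)

  \<comment> \<open>Although \<open>P\<close> may be smaller than \<open>S\<close>, nothing is lost
    inside \<open>\<Gamma>\<close>: a vector \<open>v\<close> of the left side is killed by
    \<open>A\<close> as a member of \<open>span S\<close> and by \<open>\<Gamma>p\<close> as a
    member of \<open>\<Gamma>\<close>, hence by \<open>R\<close>. Here \<open>v\<close> is the right
    argument, while membership in the complement of \<open>R\<close> wants it on the left;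
    \<open>reflexive_extended\<close> makes the swap.\<close>
  have "span S \<inter> \<Gamma> \<subseteq> span P \<inter> \<Gamma>"
  proof
    fix v assume v: "v \<in> span S \<inter> \<Gamma>"
    then have vV: "v \<in> carrier V" using \<Gamma>V by auto
    have "\<sigma> v r = \<zero>\<^bsub>F\<^esub>" if r: "r \<in> R" for r
    proof -
      have "r \<in> A <+>\<^bsub>V\<^esub> \<Gamma>p"
        using r RV coset_in_quot_image_iff[OF \<Gamma>p subspaceD(1)[OF A]] by (auto simp: R_def dT)
      then obtain a b where ab: "a \<in> A" "b \<in> \<Gamma>p" "r = a \<oplus>\<^bsub>V\<^esub> b" by (auto simp: set_add_iff)
      then have "a \<in> carrier V" "b \<in> carrier V" "\<sigma> a v = \<zero>\<^bsub>F\<^esub>" "\<sigma> b v = \<zero>\<^bsub>F\<^esub>"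
        using v by (auto simp: A_def \<Gamma>p_def orth_def)
      then have "\<sigma> r v = \<zero>\<^bsub>F\<^esub>" using ab vV by (simp add: form_add)
      moreover have "r \<in> W" using r R(2) by blast
      ultimately show ?thesis using reflexive_extended vV by blast
    qed
    then have "v \<in> orth F V \<sigma> (span R)" unfolding orth_span[OF RV] using vV by (simp add: orth_def)
    then show "v \<in> span P \<inter> \<Gamma>" using v orth_R by simp
  qed
  then have le: "sdim F V (span S \<inter> \<Gamma>) \<le> sdim F V (span P \<inter> \<Gamma>)"
    by (intro sdim_mono subspace_Int spanS spanP \<Gamma>(1))
  \<comment> \<open>The bidual has weight at least the dimension of \<open>P\<close>, so its defect
    is at least the dimension of \<open>span P \<inter> \<Gamma>\<close>, which dominates the defect
    of \<open>T\<close> by \<open>le\<close>.\<close>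
  have "sdim F Vk (d' (d T)) + sdim F V (span P \<inter> \<Gamma>) = sdim Fq V P"
    using sdim_quot_image[OF \<Gamma>(1) spanP] sdim_span[OF P] by (simp add: ddT Vk_def)
  moreover have "sdim Fq V P \<le> weight F K Vk U (d' (d T))"
    using sdim_le_weight_quot_image[OF \<Gamma>(1,3) spanP P in_own_span[OF PV]]
    by (simp add: ddT Vk_def U_def)
  ultimately have 6: "defect F K Vk U (d' (d T)) \<ge> defect F K Vk U T"
    using le unfolding defect by (simp add: defect_def)

  have 7: "d T \<subseteq> d T'" if "T' \<subseteq> T" for T'
  proof -
    let ?S' = "{w \<in> W. \<Gamma> +>\<^bsub>V\<^esub> w \<in> T'}"
    \<comment> \<open>Preimages and spans preserve inclusions; only the orthogonal complement
      reverses them.\<close>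
    have "span ?S' \<subseteq> span S" using that by (intro span_is_monotone) (auto simp: S_def)
    then have "A \<subseteq> orth F V \<sigma> (span ?S')" by (auto simp: A_def orth_def)
    then show ?thesis unfolding d_def subspace_dual_def A_def S_def by (rule quot_image_mono)
  qed
  show ?thesis by (intro conjI impI allI 1 2 3 4 5 6 7)
qed

end

section \<open>From a form on \<open>W\<close> with a given extension to the extension alone\<close>

theorem theorem1p25:
  fixes F :: "('a, 'r) ring_scheme"
    and V :: "('a, 'v, 'd) module_scheme"
    and K :: "'a set"
    and W \<Gamma> :: "'v set"
    and \<sigma>' \<sigma> :: "'v \<Rightarrow> 'v \<Rightarrow> 'a"
    and q m n k :: nat
    and T :: "'v set set"
  defines "Fq \<equiv> F\<lparr>carrier := K\<rparr>"
    and "\<Gamma>p \<equiv> orth F V \<sigma> \<Gamma>"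
    and "Vk \<equiv> quot_space V \<Gamma>"
    and "U \<equiv> quot_image V \<Gamma> W"
  defines "Vnk \<equiv> quot_space V \<Gamma>p"
    and "Ud \<equiv> quot_image V \<Gamma>p W"
    and "d \<equiv> subspace_dual F V \<sigma> W \<Gamma> \<Gamma>p"
    and "d' \<equiv> subspace_dual F V \<sigma> W \<Gamma>p \<Gamma>"
  assumes q: "primepow q" and m: "0 < m" and k: "1 \<le> k" "k < n"
    and F: "field F" "card (carrier F) = q ^ m"
    and K: "subfield K F" "card K = q"
    and V: "vectorspace F V" "vectorspace.fin_dim F V" "vectorspace.dim F V = n"
    and W: "VectorSpace.subspace Fq W V" "vectorspace.fin_dim Fq (V\<lparr>carrier := W\<rparr>)" "sdim Fq V W = n"
      "lspan F V W = carrier V"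
    and \<sigma>': "bilinear_form Fq (V\<lparr>carrier := W\<rparr>) \<sigma>'"
      "reflexive_form Fq (V\<lparr>carrier := W\<rparr>) \<sigma>'"
      "nondegenerate_form Fq (V\<lparr>carrier := W\<rparr>) \<sigma>'"
    and \<sigma>: "bilinear_form F V \<sigma>" "\<forall>x\<in>W. \<forall>y\<in>W. \<sigma> x y = \<sigma>' x y"
    and \<Gamma>: "VectorSpace.subspace F \<Gamma> V" "sdim F V \<Gamma> = n - k" "\<Gamma> \<inter> W = {\<zero>\<^bsub>V\<^esub>}"
    and T: "VectorSpace.subspace F T Vk" "lspan F Vk (T \<inter> U) = T"
  shows "d (carrier Vk) = {\<zero>\<^bsub>Vnk\<^esub>} \<and>
    int (sdim F Vnk (d T)) = int n - int k - defect F K Vk U T \<and>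
    (\<Gamma>p \<inter> W = {\<zero>\<^bsub>V\<^esub>} \<longrightarrow>
      int (weight F K Vnk Ud (d T)) \<ge> int n - int (weight F K Vk U T)) \<and>
    (\<Gamma>p \<inter> W = {\<zero>\<^bsub>V\<^esub>} \<longrightarrow>
      defect F K Vnk Ud (d T) \<ge> int k - int (sdim F Vk T)) \<and>
    (d' (d T) \<subseteq> T \<and> defect F K Vk U (d' (d T)) \<ge> defect F K Vk U T) \<and>
    (\<forall>T'. VectorSpace.subspace F T' Vk \<and> T' \<subseteq> T \<and> lspan F Vk (T' \<inter> U) = T' \<longrightarrow> d T \<subseteq> d T')"
proof -
  \<comment> \<open>An infinite carrier would have \<open>card\<close> equal to 0, whereas
    \<open>q ^ m\<close> is positive.\<close>
  have finF: "finite (carrier F)"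
    using F(2) primepow_gt_0_nat[OF q] card_ge_0_finite by (metis zero_less_power)
  have finV: "finite (carrier V)"
  proof -
    interpret vectorspace F V by (rule V(1))
    show ?thesis using V(2) finF by (rule card_carrier_eq(1))
  qed
  \<comment> \<open>Sums and \<open>K\<close>-multiples of vectors of \<open>W\<close> stay in
    \<open>W\<close>, where the two forms agree; this carries the bilinearity identities from
    \<open>\<sigma>'\<close> to \<open>\<sigma>\<close>.\<close>
  have closed: "\<And>x y. x \<in> W \<Longrightarrow> y \<in> W \<Longrightarrow> x \<oplus>\<^bsub>V\<^esub> y \<in> W"
    "\<And>c x. c \<in> K \<Longrightarrow> x \<in> W \<Longrightarrow> c \<odot>\<^bsub>V\<^esub> x \<in> W"
  proof -
    interpret vectorspace Fq V
      unfolding Fq_def using V(1) K(1) by (rule vectorspace_restrict_scalars)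
    show "\<And>x y. x \<in> W \<Longrightarrow> y \<in> W \<Longrightarrow> x \<oplus>\<^bsub>V\<^esub> y \<in> W"
      using subspaceD(3)[OF W(1)] .
    show "\<And>c x. c \<in> K \<Longrightarrow> x \<in> W \<Longrightarrow> c \<odot>\<^bsub>V\<^esub> x \<in> W"
      using subspaceD(4)[OF W(1)] by (simp add: Fq_def)
  qed
  have bil: "bilinear_form Fq (V\<lparr>carrier := W\<rparr>) \<sigma>"
    using \<sigma>'(1) \<sigma>(2) closed unfolding bilinear_form_def Fq_def by (auto simp: Pi_iff)
  have refl: "reflexive_form Fq (V\<lparr>carrier := W\<rparr>) \<sigma>"
    using \<sigma>'(2) \<sigma>(2) by (simp add: reflexive_form_def)
  have nondeg: "nondegenerate_form Fq (V\<lparr>carrier := W\<rparr>) \<sigma>"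
    using \<sigma>'(3) \<sigma>(2) by (simp add: nondegenerate_form_def)
  interpret E: extended_form F V \<sigma> K W
  proof (intro extended_form.intro finite_vectorspace.intro finite_vectorspace_axioms.intro
      bilinear_space.intro bilinear_space_axioms.intro extended_form_axioms.intro)
    show "sdim (F\<lparr>carrier := K\<rparr>) V W = vectorspace.dim F V" using W(3) V(3) by (simp add: Fq_def)
  qed (use V(1) finF finV \<sigma>(1) K(1) W(1,4) bil refl nondeg in \<open>simp_all add: Fq_def\<close>)
  show ?thesis
    using E.delsarte_dual_properties[OF V(3) less_imp_le[OF k(2)] \<Gamma> T[unfolded Vk_def U_def]]
    unfolding Vnk_def Ud_def d_def d'_def Vk_def U_def \<Gamma>p_def by blast
qed

end
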